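(* Let $d\ge 4$, and set $k_1=\lceil d/2\rceil$ and $k_2=\lfloor d/2\rfloor$, so that $k_1+k_2=d$. Then there exist compact sets $E,F\subset\mathbb{R}^d$ such that: (i) only a single distance is realised between $E$ and $F$, that is, $D(E,F)=\{\sqrt2\}$, and so $\dim_{\mathrm H} D(E,F)=0$; (ii) for all $\theta\in[0,1]$, the Fourier spectra satisfy $$\dim_{\mathrm F}^{\theta}E\ge\min\{\theta k_1,\ k_1-1\}\qquad\text{and}\qquad \dim_{\mathrm F}^{\theta}F\ge\min\{\theta k_2,\ k_2-1\}.$$ In particular, when $\theta=1/2$, $\dim_{\mathrm F}^{1/2}E+\dim_{\mathrm F}^{1/2}F=d/2$, so that $$\frac{\dim_{\mathrm F}^{1/2}E+\dim_{\mathrm F}^{1/2}F}{2}-\frac d4=0=\dim_{\mathrm H} D(E,F).$$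
   Context: $D(E,F)=\{|x-y|:x\in E,\ y\in F\}$; $\dim_{\mathrm H}$ is Hausdorff dimension. For a finite Borel measure $\mu$ on $\mathbb{R}^d$, $\widehat\mu(z)=\int e^{-2\pi i z\cdot x}\,d\mu(x)$. For $s\ge 0$ define $$\mathcal{J}_{s,\theta}(\mu)=\left(\int_{\mathbb{R}^d}|\widehat\mu(z)|^{2/\theta}|z|^{s/\theta-d}\,dz\right)^{\theta}\ (\theta\in(0,1]),\qquad \mathcal{J}_{s,0}(\mu)=\sup_{z\in\mathbb{R}^d}|\widehat\mu(z)|^2|z|^s.$$ The Fourier spectrum of $\mu$ at $\theta\in[0,1]$ is $\dim_{\mathrm F}^{\theta}\mu=\sup\{s\ge 0:\mathcal{J}_{s,\theta}(\mu)<\infty\}$ (with $\sup\emptyset=0$). For a Borel set $E\subseteq\mathbb{R}^d$, $\dim_{\mathrm F}^{\theta}E=\sup\{\min\{\dim_{\mathrm F}^{\theta}\mu,d\}:\mu\in\mathcal{M}(E)\}$, where $\mathcal{M}(E)$ is the set of finite, non-zero Borel measures with support contained in $E$. *)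

theory Defs
  imports "HOL-Analysis.Analysis"
begin

text \<open>Real power of a nonnegative base with the convention \<open>0\<^sup>0 = 1\<close>; the library has
  \<open>0 powr 0 = 0\<close>.\<close>

definition rpow :: "real \<Rightarrow> real \<Rightarrow> real" where
  "rpow r s = (if s = 0 then 1 else r powr s)"

definition distance_set :: "'a::real_normed_vector set \<Rightarrow> 'a set \<Rightarrow> real set" where
  "distance_set E F = {norm (x - y) | x y. x \<in> E \<and> y \<in> F}"

text \<open>Boundedness of the covering sets is required because \<open>diameter\<close> is real-valued and carries
  no information on unbounded sets. An empty covering set contributes \<open>0\<close> even when \<open>s = 0\<close>.\<close>

definition hausdorff_premeasure :: "real \<Rightarrow> real \<Rightarrow> 'a::metric_space set \<Rightarrow> ennreal" where
  "hausdorff_premeasure s \<delta> A =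
     (INF U \<in> {U :: nat \<Rightarrow> 'a set. A \<subseteq> (\<Union>i. U i) \<and> (\<forall>i. bounded (U i) \<and> diameter (U i) \<le> \<delta>)}.
        (\<Sum>i. if U i = {} then 0 else ennreal (rpow (diameter (U i)) s)))"

definition hausdorff_measure :: "real \<Rightarrow> 'a::metric_space set \<Rightarrow> ennreal" where
  "hausdorff_measure s A = (SUP \<delta> \<in> {0<..}. hausdorff_premeasure s \<delta> A)"

definition hausdorff_dim :: "'a::metric_space set \<Rightarrow> ereal" where
  "hausdorff_dim A = Inf {ereal s | s. 0 \<le> s \<and> hausdorff_measure s A = 0}"

definition fourier_transform :: "'a::euclidean_space measure \<Rightarrow> 'a \<Rightarrow> complex" where
  "fourier_transform \<mu> z = (\<integral>x. exp (- 2 * of_real pi * \<i> * of_real (z \<bullet> x)) \<partial>\<mu>)"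

text \<open>The integral and its \<open>\<theta>\<close>-th power are taken in \<open>[0, \<infinity>]\<close>, so that the value \<open>\<infinity>\<close> records
  divergence.\<close>

definition fourier_energy :: "real \<Rightarrow> real \<Rightarrow> 'a::euclidean_space measure \<Rightarrow> ennreal" where
  "fourier_energy s \<theta> \<mu> =
     (if \<theta> = 0 then SUP z. ennreal ((norm (fourier_transform \<mu> z))\<^sup>2 * rpow (norm z) s)
      else
        let I = (\<integral>\<^sup>+ z. ennreal (norm (fourier_transform \<mu> z) powr (2 / \<theta>)
                   * norm z powr (s / \<theta> - real DIM('a))) \<partial>lborel)
        in if I = \<infinity> then \<infinity> else ennreal (enn2real I powr \<theta>))"

text \<open>All values over which the suprema below range are nonnegative, so inserting \<open>0\<close> only
  implements the convention \<open>sup \<emptyset> = 0\<close>.\<close>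

definition fourier_spectrum_measure :: "real \<Rightarrow> 'a::euclidean_space measure \<Rightarrow> ereal" where
  "fourier_spectrum_measure \<theta> \<mu> =
     Sup (insert 0 {ereal s | s. 0 \<le> s \<and> fourier_energy s \<theta> \<mu> < \<infinity>})"

definition measure_support :: "'a::topological_space measure \<Rightarrow> 'a set" where
  "measure_support \<mu> = {x. \<forall>U. open U \<and> x \<in> U \<longrightarrow> emeasure \<mu> U > 0}"

definition finite_borel_measures_on :: "'a::topological_space set \<Rightarrow> 'a measure set" where
  "finite_borel_measures_on E =
     {\<mu>. sets \<mu> = sets borel \<and> finite_measure \<mu> \<and> emeasure \<mu> UNIV \<noteq> 0 \<and> measure_support \<mu> \<subseteq> E}"

definition fourier_spectrum :: "real \<Rightarrow> 'a::euclidean_space set \<Rightarrow> ereal" where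
  "fourier_spectrum \<theta> E =
     Sup (insert 0 ((\<lambda>\<mu>. min (fourier_spectrum_measure \<theta> \<mu>) (ereal (real DIM('a))))
       ` finite_borel_measures_on E))"

end

theory Submission
  imports Defs
begin

text \<open>
Split the coordinates of the space into two groups of \<open>k1\<close> and \<open>k2\<close> elements, and let \<open>E\<close> and \<open>F\<close> be the unit
spheres of the corresponding orthogonal coordinate subspaces. A point of \<open>E\<close> and a point of \<open>F\<close> are orthogonal
unit vectors, so their distance is \<open>sqrt 2\<close>. What has to be understood is the Fourier spectrum of the unit
sphere of a \<open>k\<close>-dimensional coordinate subspace \<open>V\<close> of a \<open>d\<close>-dimensional space.

Lower bound. The rotation-invariant measure on the sphere has a transform that depends only on the norm \<open>r\<close>
of the \<open>V\<close>-component of the frequency. The measure is carried by unit vectors, so as a function of the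
suitably scaled \<open>r\<close> it satisfies the radial Helmholtz equation \<open>f'' + (k - 1) f'/r + f = 0\<close>. An energy
argument (\<open>bessel_energy_bound\<close>) gives \<open>f(r) = O(r\<^bsup>-(k-1)/2\<^esup>)\<close>, the decay
of the surface measure (\<open>integral_cos_coord_sphere_decay\<close>). Orthogonally to \<open>V\<close> there is no decay, and
convergence of the energy integral has to come from the weight \<open>\<bar>z\<bar>\<^bsup>s/\<theta>-d\<^esup>\<close>: this requires \<open>s < \<theta> k\<close>, while
the integral over \<open>V\<close> requires \<open>s < k - 1\<close> (\<open>fourier_energy_coord_sphere_measure_finite\<close>).

Upper bound at \<open>\<theta> = 1/2\<close>. Whatever the measure on the sphere, its transform stays above half of the
mass in a slab around the orthogonal complement of \<open>V\<close>. On this slab the weight is not integrable once \<open>s > k/2\<close>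
(\<open>fourier_energy_half_eq_infinity\<close>). For \<open>k \<ge> 2\<close> the two bounds agree, and the spectra of \<open>E\<close> and \<open>F\<close> at \<open>1/2\<close>
add up to \<open>k1/2 + k2/2 = d/2\<close>.
\<close>

section \<open>Orthogonal invariance of Lebesgue measure\<close>

text \<open>The measure of a ball depends on its radius only, and an isometry maps balls to balls of the same
radius. Vitali's theorem fills an open set with disjoint balls up to a null set, which carries this
invariance over to all open sets. Applied to the map and to its inverse, the inequality becomes an
equality.\<close>

lemma emeasure_lborel_orthogonal_image_le:
  fixes f :: "'a::euclidean_space \<Rightarrow> 'a"
  assumes f: "orthogonal_transformation f" and U: "open U"
  shows "emeasure lborel (f ` U) \<le> emeasure lborel U"
proof -
  have lin: "linear f"
    using f by (simp add: orthogonal_transformation_linear)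
  define K where "K = {(a, r). ball a r \<subseteq> U}"
  have "\<exists>i. i \<in> K \<and> x \<in> ball (fst i) (snd i) \<and> snd i < e" if "x \<in> U" "0 < e" for x e
  proof -
    obtain r where r: "r > 0" "ball x r \<subseteq> U"
      using U \<open>x \<in> U\<close> openE by blast
    have "ball x (min r (e/2)) \<subseteq> U"
      using r by (meson min.cobounded1 order_trans subset_ball)
    then have "(x, min r (e/2)) \<in> K"
      by (simp add: K_def)
    then show ?thesis
      using r \<open>0 < e\<close> by (intro exI[of _ "(x, min r (e/2))"]) (auto simp: min_def)
  qed
  then obtain C where C: "countable C" "C \<subseteq> K"
     "pairwise (\<lambda>i j. disjnt (ball (fst i) (snd i)) (ball (fst j) (snd j))) C"
     "negligible (U - (\<Union>i \<in> C. ball (fst i) (snd i)))"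
    by (rule Vitali_covering_theorem_balls)
  define N where "N = U - (\<Union>i \<in> C. ball (fst i) (snd i))"
  define V where "V = (\<Union>i\<in>C. ball (fst i) (snd i))"
  have disj: "disjoint_family_on (\<lambda>i. ball (fst i) (snd i)) C"
    using C(3) by (auto simp: disjoint_family_on_def pairwise_def disjnt_def)
  have "V \<subseteq> U"
    using C(2) by (auto simp: V_def K_def subset_iff)
  have negN: "negligible (f ` N)"
    using C(4) lin unfolding N_def
    by (intro negligible_differentiable_image_negligible[OF order_refl])
       (auto intro: linear_imp_differentiable_on)
  have fV: "f ` V = (\<Union>i\<in>C. ball (f (fst i)) (snd i))"
    unfolding V_def by (simp add: image_UN image_orthogonal_transformation_ball[OF f])
  then have fV_borel: "f ` V \<in> sets borel"
    by (simp add: C(1) open_UN)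
  have fU: "open (f ` U)"
    using U f lin open_surjective_linear_image orthogonal_transformation_surj by blast
  have "U = V \<union> N"
    using \<open>V \<subseteq> U\<close> by (auto simp: V_def N_def)
  have "AE x in lborel. x \<notin> f ` U - f ` V"
  proof -
    have "negligible (f ` U - f ` V)"
      using negN by (rule negligible_subset) (use \<open>U = V \<union> N\<close> in auto)
    then have "f ` U - f ` V \<in> null_sets lborel"
      using fU fV_borel by (subst null_sets_completion_iff[symmetric]) (auto simp: negligible_iff_null_sets)
    then show ?thesis
      by (rule AE_not_in)
  qed
  then have "emeasure lborel (f ` U) \<le> emeasure lborel (f ` V)"
    using fV_borel by (intro emeasure_mono_AE) (auto elim!: eventually_mono)
  also have "\<dots> = (\<integral>\<^sup>+i. emeasure lborel (ball (f (fst i)) (snd i)) \<partial>count_space C)"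
  proof -
    have "disjoint_family_on (\<lambda>i. f ` ball (fst i) (snd i)) C"
      using disj orthogonal_transformation_inj[OF f]
      by (auto simp: disjoint_family_on_def image_Int[symmetric])
    then have "disjoint_family_on (\<lambda>i. ball (f (fst i)) (snd i)) C"
      by (simp add: image_orthogonal_transformation_ball[OF f])
    then show ?thesis
      unfolding fV by (intro emeasure_UN_countable) (use C(1) in auto)
  qed
  also have "\<dots> = (\<integral>\<^sup>+i. emeasure lborel (ball (fst i) (snd i)) \<partial>count_space C)"
    by (intro nn_integral_cong) (metis emeasure_ball ball_empty linorder_not_le less_imp_le)
  also have "\<dots> = emeasure lborel V"
    unfolding V_def by (intro emeasure_UN_countable[symmetric]) (use C(1) disj in auto)
  also have "\<dots> \<le> emeasure lborel U"
    using \<open>V \<subseteq> U\<close> U by (intro emeasure_mono) auto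
  finally show ?thesis .
qed

lemma lborel_distr_orthogonal_transformation:
  fixes f :: "'a::euclidean_space \<Rightarrow> 'a"
  assumes f: "orthogonal_transformation f"
  shows "distr lborel borel f = lborel"
proof (rule lborel_eqI[symmetric])
  have bij: "bij f"
    using f by (simp add: orthogonal_transformation_bij)
  have inv: "orthogonal_transformation (inv f)"
    using f by (simp add: orthogonal_transformation_inv)
  have [measurable]: "f \<in> borel_measurable borel"
    using f by (intro borel_measurable_continuous_onI linear_continuous_on linear_conv_bounded_linear[THEN iffD1])
       (simp add: orthogonal_transformation_linear)
  fix l u :: 'a
  assume lu: "\<And>b. b \<in> Basis \<Longrightarrow> l \<bullet> b \<le> u \<bullet> b"
  have "open (inv f ` box l u)"
    using inv by (meson open_box open_surjective_linear_image orthogonal_transformation_linear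
        orthogonal_transformation_surj)
  then have "emeasure lborel (f ` (inv f ` box l u)) \<le> emeasure lborel (inv f ` box l u)"
    by (rule emeasure_lborel_orthogonal_image_le[OF f])
  moreover have "f ` (inv f ` box l u) = box l u"
    using bij by (simp add: bij_is_surj image_f_inv_f)
  moreover have "emeasure lborel (inv f ` box l u) \<le> emeasure lborel (box l u)"
    by (rule emeasure_lborel_orthogonal_image_le[OF inv]) (rule open_box)
  ultimately have "emeasure lborel (inv f ` box l u) = emeasure lborel (box l u)"
    by simp
  moreover have "emeasure (distr lborel borel f) (box l u) = emeasure lborel (inv f ` box l u)"
    using bij by (simp add: emeasure_distr bij_vimage_eq_inv_image)
  ultimately show "emeasure (distr lborel borel f) (box l u) = ennreal (\<Prod>b\<in>Basis. (u - l) \<bullet> b)"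
    using lu by simp
qed simp

section \<open>Decay of solutions of the radial Helmholtz equation\<close>

text \<open>The cancellation behind \<open>bessel_energy_bound\<close>: here \<open>p = r\<^sup>m\<close>, \<open>a = f(r)\<close>, \<open>b = f'(r)\<close>, and the second
derivative has been eliminated through the equation \<open>f'' = - f - m f'/r\<close>. All terms of order \<open>p\<close> and
\<open>p/r\<close> cancel and one of order \<open>p/r\<^sup>2\<close> survives.\<close>

lemma energy_derivative_identity:
  fixes r a b p m :: real
  assumes "r > 0"
  shows "(m * p / r) * (a\<^sup>2 + b\<^sup>2 + m * a * b / r)
       + p * (2 * a * b + 2 * b * (- a - m * b / r)
          + (m * (b * b + a * (- a - m * b / r)) * r - m * a * b) / r\<^sup>2)
       = - (m * p * a * b / r\<^sup>2)"
proof -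
  define q where "q = inverse r"
  have "q * r = 1" using assms by (simp add: q_def)
  then have "m * p * q * (a * a + b * b + m * a * b * q)
       + p * (2 * a * b + 2 * b * (- a - m * b * q)
          + (m * (b * b + a * (- a - m * b * q)) * r - m * a * b) * (q * q))
       = - (m * p * a * b * (q * q))"
    by algebra
  then show ?thesis
    by (simp add: divide_inverse power2_eq_square q_def)
qed

text \<open>The equation is the radial form of \<open>\<Delta>u + u = 0\<close> in dimension \<open>n + 1\<close>. The function
\<open>w = r\<^bsup>n/2\<^esup> f\<close> solves \<open>w'' + (1 + O(r\<^sup>-\<^sup>2)) w = 0\<close>, a harmonic oscillator up to an integrable
perturbation, so that its energy \<open>w\<^sup>2 + w'\<^sup>2\<close> stays bounded. The quantity \<open>E\<close> below is this energy
without the term \<open>n\<^sup>2 w\<^sup>2/(4 r\<^sup>2)\<close>; it satisfies \<open>E' \<le> n E/r\<^sup>2\<close>, which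
Gronwall's argument integrates to the fact that \<open>E exp (n/r)\<close> decreases.\<close>

lemma bessel_energy_bound:
  fixes f f' f'' :: "real \<Rightarrow> real" and n :: nat
  assumes f: "\<And>r. r > 0 \<Longrightarrow> (f has_real_derivative f' r) (at r)"
    and f': "\<And>r. r > 0 \<Longrightarrow> (f' has_real_derivative f'' r) (at r)"
    and ode: "\<And>r. r > 0 \<Longrightarrow> f r + f'' r = - real n * (f' r / r)"
  shows "\<exists>C. \<forall>r \<ge> real n + 1. r ^ n * (f r)\<^sup>2 \<le> C"
proof -
  define E where "E r = r ^ n * ((f r)\<^sup>2 + (f' r)\<^sup>2 + real n * f r * f' r / r)" for r
  define G where "G r = E r * exp (real n / r)" for r
  have dpow: "((\<lambda>r. r ^ n) has_real_derivative real n * r ^ n / r) (at r)" if "r > 0" for r :: real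
    using DERIV_pow[of n r] that by (cases n) auto
  have dE: "(E has_real_derivative - (real n * r ^ n * f r * f' r / r\<^sup>2)) (at r)" if "r > 0" for r
  proof -
    have f'': "f'' r = - f r - real n * f' r / r"
      using ode[OF that] by (simp add: algebra_simps)
    have "((\<lambda>r. (f r)\<^sup>2 + (f' r)\<^sup>2 + real n * f r * f' r / r) has_real_derivative
       2 * f r * f' r + 2 * f' r * f'' r
          + (real n * (f' r * f' r + f r * f'' r) * r - real n * f r * f' r) / r\<^sup>2) (at r)"
      apply (rule derivative_eq_intros refl f f' that | use that in simp; fail)+
      using that by (simp add: power2_eq_square algebra_simps)
    from DERIV_mult'[OF dpow[OF that] this]
    have "(E has_real_derivative (real n * r ^ n / r) * ((f r)\<^sup>2 + (f' r)\<^sup>2 + real n * f r * f' r / r)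
       + r ^ n * (2 * f r * f' r + 2 * f' r * f'' r 
          + (real n * (f' r * f' r + f r * f'' r) * r - real n * f r * f' r) / r\<^sup>2)) (at r)"
      unfolding E_def by (simp add: add.commute)
    moreover have "(real n * r ^ n / r) * ((f r)\<^sup>2 + (f' r)\<^sup>2 + real n * f r * f' r / r)
       + r ^ n * (2 * f r * f' r + 2 * f' r * f'' r 
          + (real n * (f' r * f' r + f r * f'' r) * r - real n * f r * f' r) / r\<^sup>2)
       = - (real n * r ^ n * f r * f' r / r\<^sup>2)"
      unfolding f'' using energy_derivative_identity[OF that, of n "r ^ n" "f r" "f' r"] by simp
    ultimately show ?thesis by simp
  qed
  (* The cross term in E has a coefficient n/r below 1 and is absorbed by half of the squares. *)
  have half: "r ^ n * ((f r)\<^sup>2 + (f' r)\<^sup>2) \<le> 2 * E r" and absff': "\<bar>2 * f r * f' r\<bar> \<le> (f r)\<^sup>2 + (f' r)\<^sup>2"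
    if "r \<ge> real n + 1" for r
  proof -
    have "r > 0" "real n / r \<le> 1"
      using that by auto
    show *: "\<bar>2 * f r * f' r\<bar> \<le> (f r)\<^sup>2 + (f' r)\<^sup>2"
      using sum_squares_bound[of "f r" "f' r"] sum_squares_bound[of "f r" "- f' r"] by (auto simp: abs_le_iff)
    have "\<bar>2 * f r * f' r * (real n / r)\<bar> \<le> \<bar>2 * f r * f' r\<bar> * 1"
      unfolding abs_mult[of "2 * f r * f' r"] using \<open>r > 0\<close> \<open>real n / r \<le> 1\<close>
      by (intro mult_left_mono) auto
    with * have "- ((f r)\<^sup>2 + (f' r)\<^sup>2) \<le> 2 * f r * f' r * (real n / r)"
      by linarith
    also have "\<dots> = 2 * (real n * f r * f' r / r)"
      by simp
    finally have "- ((f r)\<^sup>2 + (f' r)\<^sup>2) \<le> 2 * (real n * f r * f' r / r)" .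
    then have "((f r)\<^sup>2 + (f' r)\<^sup>2) \<le> 2 * ((f r)\<^sup>2 + (f' r)\<^sup>2 + real n * f r * f' r / r)"
      by simp
    then have "r ^ n * ((f r)\<^sup>2 + (f' r)\<^sup>2) \<le> r ^ n * (2 * ((f r)\<^sup>2 + (f' r)\<^sup>2 + real n * f r * f' r / r))"
      using \<open>r > 0\<close> by (intro mult_left_mono) auto
    then show "r ^ n * ((f r)\<^sup>2 + (f' r)\<^sup>2) \<le> 2 * E r"
      by (simp only: E_def mult.left_commute[of "r ^ n" 2])
  qed
  have G_mono: "G r \<le> G (real n + 1)" if "r \<ge> real n + 1" for r
  proof (rule DERIV_nonpos_imp_nonincreasing[OF that])
    fix x assume x: "real n + 1 \<le> x" "x \<le> r"
    then have "x > 0" by linarith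
    have "(G has_real_derivative (- (real n * x ^ n * f x * f' x / x\<^sup>2) - E x * (real n / x\<^sup>2)) * exp (real n / x)) (at x)"
      unfolding G_def
      apply (rule derivative_eq_intros refl dE \<open>x > 0\<close> | use \<open>x > 0\<close> in simp; fail)+
      using \<open>x > 0\<close> by (simp add: power2_eq_square algebra_simps)
    moreover have "(- (real n * x ^ n * f x * f' x / x\<^sup>2) - E x * (real n / x\<^sup>2)) * exp (real n / x) \<le> 0"
    proof -
      have "- (2 * f x * f' x) \<le> (f x)\<^sup>2 + (f' x)\<^sup>2"
        using absff'[OF x(1)] by linarith
      then have "x ^ n * (- (2 * f x * f' x)) \<le> x ^ n * ((f x)\<^sup>2 + (f' x)\<^sup>2)"
        using \<open>x > 0\<close> by (intro mult_left_mono) auto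
      also have "\<dots> \<le> 2 * E x"
        by (rule half[OF x(1)])
      finally have "- (x ^ n * f x * f' x) - E x \<le> 0"
        by (simp add: algebra_simps)
      then have "(- (x ^ n * f x * f' x) - E x) * (real n / x\<^sup>2) * exp (real n / x) \<le> 0"
        by (intro mult_nonpos_nonneg) auto
      then show ?thesis
        by (simp add: algebra_simps)
    qed
    ultimately show "\<exists>y. (G has_real_derivative y) (at x) \<and> y \<le> 0"
      by blast
  qed
  have "r ^ n * (f r)\<^sup>2 \<le> 2 * G (real n + 1)" if "r \<ge> real n + 1" for r
  proof -
    have "r > 0" using that by linarith
    have "r ^ n * (f r)\<^sup>2 \<le> r ^ n * ((f r)\<^sup>2 + (f' r)\<^sup>2)"
      using \<open>r > 0\<close> by (intro mult_left_mono) auto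
    also have *: "\<dots> \<le> 2 * E r"
      by (rule half[OF that])
    also have "E r \<ge> 0"
    proof -
      have "0 \<le> r ^ n * ((f r)\<^sup>2 + (f' r)\<^sup>2)"
        using \<open>r > 0\<close> by simp
      with * show ?thesis by linarith
    qed
    then have "E r * 1 \<le> G r"
      unfolding G_def using \<open>r > 0\<close> by (intro mult_left_mono) auto
    then have "2 * E r \<le> 2 * G (real n + 1)"
      using G_mono[OF that] by simp
    finally show ?thesis .
  qed
  then show ?thesis by blast
qed

text \<open>Large \<open>r\<close> gives the exponent \<open>n\<close> and boundedness gives the exponent \<open>0\<close>. All exponents in between are
available on the whole half-line with a single constant, and the energy estimate uses exponents that
vary with the point.\<close>

lemma bessel_decay:
  fixes f f' f'' :: "real \<Rightarrow> real" and n :: nat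
  assumes f: "\<And>r. r > 0 \<Longrightarrow> (f has_real_derivative f' r) (at r)"
    and f': "\<And>r. r > 0 \<Longrightarrow> (f' has_real_derivative f'' r) (at r)"
    and ode: "\<And>r. r > 0 \<Longrightarrow> f r + f'' r = - real n * (f' r / r)"
    and bounded: "\<And>r. r > 0 \<Longrightarrow> \<bar>f r\<bar> \<le> m"
  shows "\<exists>C\<ge>0. \<forall>r>0. \<forall>\<tau>\<in>{0..real n}. (f r)\<^sup>2 \<le> C * r powr (-\<tau>)"
proof -
  obtain C where C: "\<And>r. r \<ge> real n + 1 \<Longrightarrow> r ^ n * (f r)\<^sup>2 \<le> C"
    using bessel_energy_bound[OF f f' ode] by blast
  define R where "R = real n + 1"
  define D where "D = max C (m\<^sup>2 * R powr real n)"
  have "R \<ge> 1" by (simp add: R_def)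
  have "m \<ge> 0" using bounded[of 1] by simp
  then have "D \<ge> 0" unfolding D_def by (simp add: le_max_iff_disj)
  have "(f r)\<^sup>2 \<le> D * r powr (-\<tau>)" if "r > 0" "0 \<le> \<tau>" "\<tau> \<le> real n" for r \<tau>
  proof (cases "r \<ge> R")
    case True
    have "(f r)\<^sup>2 = (r ^ n * (f r)\<^sup>2) * r powr (- real n)"
      using \<open>r > 0\<close> by (simp add: powr_minus powr_realpow field_simps)
    also have "\<dots> \<le> D * r powr (- real n)"
      using C[of r] True by (intro mult_right_mono) (auto simp: D_def R_def)
    also have "\<dots> \<le> D * r powr (- \<tau>)"
      using True \<open>R \<ge> 1\<close> that \<open>D \<ge> 0\<close> by (intro mult_left_mono powr_mono) auto
    finally show ?thesis .
  next
    case False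
    have "(f r)\<^sup>2 \<le> m\<^sup>2 * 1"
      using bounded[OF \<open>r > 0\<close>] by (simp add: abs_le_square_iff[symmetric])
    also have "1 \<le> R powr real n * r powr (-\<tau>)"
    proof -
      have "1 \<le> R powr (real n - \<tau>)"
        using \<open>R \<ge> 1\<close> that by (simp add: ge_one_powr_ge_zero)
      also have "\<dots> = R powr real n * R powr (- \<tau>)"
        by (simp add: powr_add[symmetric])
      also have "\<dots> \<le> R powr real n * r powr (-\<tau>)"
        using False that by (intro mult_left_mono powr_mono2') auto
      finally show ?thesis .
    qed
    then have "m\<^sup>2 * 1 \<le> m\<^sup>2 * (R powr real n * r powr (-\<tau>))"
      by (intro mult_left_mono) auto
    also have "\<dots> \<le> D * r powr (-\<tau>)"
      unfolding mult.assoc[symmetric] by (intro mult_right_mono) (auto simp: D_def)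
    finally show ?thesis .
  qed
  then show ?thesis using \<open>D \<ge> 0\<close> by auto
qed

section \<open>Coordinate subspaces and their unit spheres\<close>

definition coord_proj :: "'a::euclidean_space set \<Rightarrow> 'a \<Rightarrow> 'a" where
  "coord_proj K x = (\<Sum>b\<in>K. (x \<bullet> b) *\<^sub>R b)"

definition coord_sphere :: "'a::euclidean_space set \<Rightarrow> 'a set" where
  "coord_sphere K = {x. norm x = 1 \<and> coord_proj K x = x}"

lemma linear_coord_proj: "linear (coord_proj K)"
  unfolding coord_proj_def
  by (rule linearI) (simp_all add: inner_add_left scaleR_add_left sum.distrib scaleR_sum_right)

lemma continuous_on_coord_proj [continuous_intros]:
  "continuous_on S f \<Longrightarrow> continuous_on S (\<lambda>x. coord_proj K (f x))"
  unfolding coord_proj_def by (intro continuous_intros)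

lemma borel_measurable_coord_proj [measurable]:
  "coord_proj K \<in> borel_measurable borel"
  by (intro borel_measurable_continuous_onI continuous_intros)

lemma coord_proj_inner_Basis:
  assumes "K \<subseteq> Basis" "b \<in> Basis"
  shows "coord_proj K x \<bullet> b = (if b \<in> K then x \<bullet> b else 0)"
proof -
  have "coord_proj K x \<bullet> b = (\<Sum>c\<in>K. if c = b then x \<bullet> b else 0)"
    unfolding coord_proj_def inner_sum_left inner_scaleR_left using assms
    by (intro sum.cong) (auto simp: inner_Basis)
  also have "\<dots> = (if b \<in> K then x \<bullet> b else 0)"
    using finite_subset[OF assms(1)] by simp
  finally show ?thesis .
qed

lemma coord_proj_idem: "K \<subseteq> Basis \<Longrightarrow> coord_proj K (coord_proj K x) = coord_proj K x"
  by (rule euclidean_eqI) (simp add: coord_proj_inner_Basis)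

lemma coord_proj_eq_iff: "K \<subseteq> Basis \<Longrightarrow> coord_proj K x = x \<longleftrightarrow> (\<forall>b\<in>Basis - K. x \<bullet> b = 0)"
  by (auto simp: euclidean_eq_iff[where 'a='a] coord_proj_inner_Basis)

lemma coord_proj_Basis: "K \<subseteq> Basis \<Longrightarrow> b \<in> K \<Longrightarrow> coord_proj K b = b"
  by (auto simp: coord_proj_eq_iff inner_Basis)

lemma coord_proj_inner_commute: "coord_proj K x \<bullet> y = x \<bullet> coord_proj K y"
  by (simp add: coord_proj_def inner_sum_left inner_sum_right mult.commute inner_commute)

lemma norm_coord_proj_le: "K \<subseteq> Basis \<Longrightarrow> norm (coord_proj K x) \<le> norm x"
  by (rule norm_le_componentwise) (simp add: coord_proj_inner_Basis)

lemma compact_coord_sphere: "compact (coord_sphere K)"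
proof -
  have "coord_sphere K = sphere 0 1 \<inter> {x. coord_proj K x = x}"
    by (auto simp: coord_sphere_def)
  moreover have "closed {x. coord_proj K x = x}"
    by (intro closed_Collect_eq continuous_intros)
  ultimately show ?thesis
    by (simp add: compact_Int_closed)
qed

lemma Basis_in_coord_sphere: "K \<subseteq> Basis \<Longrightarrow> b \<in> K \<Longrightarrow> b \<in> coord_sphere K"
  by (auto simp: coord_sphere_def coord_proj_Basis)

text \<open>The reflection in the hyperplane orthogonal to \<open>w\<close>. Since division by zero gives zero, it is the
identity for \<open>w = 0\<close>, the right value for \<open>householder_swap\<close> when \<open>u = v\<close>.\<close>

definition householder :: "'a::euclidean_space \<Rightarrow> 'a \<Rightarrow> 'a" where
  "householder w x = x - (2 * (x \<bullet> w) / (w \<bullet> w)) *\<^sub>R w"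

lemma householder_inner_commute: "householder w x \<bullet> y = x \<bullet> householder w y"
  by (simp add: householder_def inner_diff_left inner_diff_right inner_commute)

lemma householder_involution: "householder w (householder w x) = x"
  by (cases "w = 0") (simp_all add: householder_def inner_diff_left diff_divide_distrib scaleR_diff_left)

lemma linear_householder: "linear (householder w)"
  by (rule linearI) (simp_all add: householder_def inner_add_left algebra_simps add_divide_distrib)

lemma orthogonal_transformation_householder: "orthogonal_transformation (householder w)"
  unfolding orthogonal_transformation_def
  by (metis linear_householder householder_inner_commute householder_involution)

lemma householder_swap:
  assumes "norm u = norm v"
  shows "householder (u - v) u = v"
proof (cases "u = v")
  case False
  have "u \<bullet> u = v \<bullet> v"
    using assms by (simp add: dot_square_norm)
  then have "(u - v) \<bullet> (u - v) = 2 * (u \<bullet> (u - v))"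
    by (simp add: inner_diff_left inner_diff_right inner_commute)
  moreover have "(u - v) \<bullet> (u - v) \<noteq> 0"
    using False by simp
  ultimately have ratio: "2 * (u \<bullet> (u - v)) / ((u - v) \<bullet> (u - v)) = 1"
    by (metis divide_self)
  show ?thesis
    unfolding householder_def ratio by simp
qed (simp add: householder_def)

text \<open>Reflections in vectors of the coordinate subspace act on that subspace and fix its complement, and
any two of its vectors of equal norm are exchanged by one of them; this is the symmetry that makes
the Fourier transform of the sphere radial.\<close>

lemma coord_proj_householder:
  assumes "coord_proj K w = w"
  shows "coord_proj K (householder w x) = householder w (coord_proj K x)"
proof -
  have "coord_proj K x \<bullet> w = x \<bullet> w"
    using assms by (simp add: coord_proj_inner_commute)
  then show ?thesis
    using assms linear_coord_proj[of K] by (simp add: householder_def linear_diff linear_scale)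
qed

section \<open>A rotation-invariant measure on a coordinate sphere\<close>

text \<open>The surface measure up to a constant, encoded as the image of Lebesgue measure on the unit ball under
the direction of the projection. With this encoding its rotation invariance is that of Lebesgue measure. The points without
a direction are cut off by the indicator, so that the default value \<open>sgn 0 = 0\<close> carries no mass.\<close>

definition coord_sphere_measure :: "'a::euclidean_space set \<Rightarrow> 'a measure" where
  "coord_sphere_measure K =
     distr (density lborel (indicator {x \<in> ball 0 1. coord_proj K x \<noteq> 0})) borel
       (\<lambda>x. sgn (coord_proj K x))"

lemma open_ball_coord_proj_nonzero: "open {x \<in> ball 0 1. coord_proj K x \<noteq> (0::'a::euclidean_space)}"
proof -
  have "open {x::'a. coord_proj K x \<noteq> 0}"
    by (intro open_Collect_neq continuous_intros)
  moreover have "{x \<in> ball 0 1. coord_proj K x \<noteq> (0::'a)} = ball 0 1 \<inter> {x. coord_proj K x \<noteq> 0}"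
    by auto
  ultimately show ?thesis
    by (metis open_Int open_ball)
qed

lemma measurable_sgn_coord_proj [measurable]:
  "(\<lambda>x::'a::euclidean_space. sgn (coord_proj K x)) \<in> borel_measurable borel"
  unfolding sgn_div_norm by measurable

lemma sets_coord_sphere_measure [simp, measurable_cong]: "sets (coord_sphere_measure K) = sets borel"
  by (simp add: coord_sphere_measure_def)

lemma space_coord_sphere_measure [simp]: "space (coord_sphere_measure K) = UNIV"
  by (simp add: coord_sphere_measure_def)

lemma emeasure_coord_sphere_measure_UNIV:
  "emeasure (coord_sphere_measure K) UNIV = emeasure lborel {x \<in> ball 0 1. coord_proj K x \<noteq> (0::'a::euclidean_space)}"
  using open_ball_coord_proj_nonzero[of K] unfolding coord_sphere_measure_def
  by (subst emeasure_distr) (auto simp: emeasure_density)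

lemma finite_measure_coord_sphere_measure: "finite_measure (coord_sphere_measure K)"
proof (rule finite_measureI)
  have "emeasure lborel {x \<in> ball 0 1. coord_proj K x \<noteq> 0} \<le> emeasure lborel (ball (0::'a) 1)"
    by (intro emeasure_mono) auto
  also have "\<dots> < \<infinity>"
    by (intro emeasure_bounded_finite bounded_ball)
  finally show "emeasure (coord_sphere_measure K) (space (coord_sphere_measure K)) \<noteq> \<infinity>"
    by (simp add: emeasure_coord_sphere_measure_UNIV)
qed

lemma emeasure_coord_sphere_measure_UNIV_nonzero:
  assumes "K \<subseteq> Basis" "K \<noteq> {}"
  shows "emeasure (coord_sphere_measure K) UNIV \<noteq> 0"
proof
  assume "emeasure (coord_sphere_measure K) UNIV = 0"
  then have "{x \<in> ball 0 1. coord_proj K x \<noteq> 0} \<in> null_sets lborel"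
    using open_ball_coord_proj_nonzero[of K] by (simp add: emeasure_coord_sphere_measure_UNIV null_sets_def)
  then have "negligible {x \<in> ball 0 1. coord_proj K x \<noteq> 0}"
    by (simp add: negligible_iff_null_sets null_sets_completionI)
  then have "{x \<in> ball 0 1. coord_proj K x \<noteq> 0} = {}"
    using open_ball_coord_proj_nonzero[of K] open_not_negligible by blast
  moreover obtain b where "b \<in> K" using assms by blast
  then have "(1/2) *\<^sub>R b \<in> {x \<in> ball 0 1. coord_proj K x \<noteq> 0}"
    using assms linear_coord_proj[of K] by (auto simp: linear_scale coord_proj_Basis)
  ultimately show False by blast
qed

lemma AE_coord_sphere_measure: 
  assumes "K \<subseteq> Basis" shows "AE y in coord_sphere_measure K. y \<in> coord_sphere K"
proof -
  have "coord_sphere K \<in> sets borel"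
    by (intro borel_closed compact_imp_closed compact_coord_sphere)
  moreover have "sgn (coord_proj K x) \<in> coord_sphere K" if "coord_proj K x \<noteq> 0" for x
    using that linear_coord_proj[of K] assms
    by (simp add: coord_sphere_def norm_sgn sgn_div_norm linear_scale coord_proj_idem)
  ultimately show ?thesis
    using open_ball_coord_proj_nonzero[of K] unfolding coord_sphere_measure_def
    by (subst AE_distr_iff) (auto simp: AE_density indicator_def intro!: AE_I2)
qed

lemma measure_support_subset_closed:
  assumes "closed E" "sets \<mu> = sets borel" "AE y in \<mu>. y \<in> E"
  shows "measure_support \<mu> \<subseteq> E"
proof
  fix x assume x: "x \<in> measure_support \<mu>"
  show "x \<in> E"
  proof (rule ccontr)
    assume "x \<notin> E"
    then have "emeasure \<mu> (- E) > 0"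
      using x \<open>closed E\<close> by (auto simp: measure_support_def)
    moreover have "- E \<in> sets \<mu>"
      using assms by simp
    then have "emeasure \<mu> (- E) = 0"
      using assms(3) sets_eq_imp_space_eq[OF assms(2)] by (subst (asm) AE_iff_measurable[of "-E"]) auto
    ultimately show False by simp
  qed
qed

lemma coord_sphere_measure_in_finite_borel_measures_on:
  assumes "K \<subseteq> Basis" "K \<noteq> {}"
  shows "coord_sphere_measure K \<in> finite_borel_measures_on (coord_sphere K)"
  unfolding finite_borel_measures_on_def
  using assms finite_measure_coord_sphere_measure[of K] emeasure_coord_sphere_measure_UNIV_nonzero[of K]
    measure_support_subset_closed[OF compact_imp_closed[OF compact_coord_sphere] _ AE_coord_sphere_measure]
  by auto

text \<open>The direction map commutes with \<open>f\<close>, and the ball together with the set of points that have a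
direction is invariant under \<open>f\<close>.\<close>

lemma coord_sphere_measure_invariant:
  assumes f: "orthogonal_transformation f" and comm: "\<And>x. coord_proj K (f x) = f (coord_proj K x)"
  shows "distr (coord_sphere_measure K) borel f = coord_sphere_measure K"
proof -
  define S where "S = {x \<in> ball 0 1. coord_proj K x \<noteq> (0::'a)}"
  have [measurable]: "S \<in> sets borel"
    using open_ball_coord_proj_nonzero[of K] by (simp add: S_def)
  have lin: "linear f"
    using f by (simp add: orthogonal_transformation_linear)
  have [measurable]: "f \<in> borel_measurable borel"
    using lin by (intro borel_measurable_continuous_onI linear_continuous_on)
       (simp add: linear_conv_bounded_linear)
  have norm: "norm (f x) = norm x" for x
    using f by (simp add: orthogonal_transformation)
  have "f x = 0 \<longleftrightarrow> x = 0" for x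
    using norm by (metis norm_eq_zero)
  then have "f x \<in> S \<longleftrightarrow> x \<in> S" for x
    by (auto simp: S_def comm norm)
  then have ind: "(\<lambda>x. indicator S (f x) :: ennreal) = indicator S"
    by (auto simp: indicator_def)
  have "sgn (f x) = f (sgn x)" for x
    using lin by (simp add: sgn_div_norm norm linear_scale)
  then have comm': "f \<circ> (\<lambda>x. sgn (coord_proj K x)) = (\<lambda>x. sgn (coord_proj K x)) \<circ> f"
    by (auto simp: comm)
  have "distr (coord_sphere_measure K) borel f
      = distr (density lborel (indicator S)) borel (f \<circ> (\<lambda>x. sgn (coord_proj K x)))"
    unfolding coord_sphere_measure_def S_def[symmetric] by (subst distr_distr) auto
  also have "\<dots> = distr (distr (density lborel (\<lambda>x. indicator S (f x))) borel f) borel (\<lambda>x. sgn (coord_proj K x))"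
    unfolding comm' ind by (subst distr_distr) auto
  also have "distr (density lborel (\<lambda>x. indicator S (f x))) borel f = density (distr lborel borel f) (indicator S)"
    by (subst density_distr) auto
  also have "\<dots> = density lborel (indicator S)"
    by (simp add: lborel_distr_orthogonal_transformation[OF f])
  finally show ?thesis
    by (simp add: coord_sphere_measure_def S_def)
qed

section \<open>The Fourier transform of the sphere\<close>

lemma cos_first_order_bound: "\<bar>cos (x + h) - cos x + h * sin x\<bar> \<le> (h::real)\<^sup>2"
proof -
  have sin_lip: "\<bar>sin (x + s) - sin x\<bar> \<le> \<bar>s\<bar>" for s
  proof -
    have "norm (sin (x + s) - sin x) \<le> 1 * norm (x + s - x)"
      by (rule field_differentiable_bound[of UNIV sin cos])
         (auto intro: DERIV_sin[THEN DERIV_subset] abs_cos_le_one)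
    then show ?thesis by simp
  qed
  let ?\<phi> = "\<lambda>s. cos (x + s) + s * sin x"
  have "norm (?\<phi> h - ?\<phi> 0) \<le> \<bar>h\<bar> * norm (h - 0)"
  proof (rule field_differentiable_bound[of "closed_segment 0 h" ?\<phi> "\<lambda>s. sin x - sin (x + s)"])
    show "(?\<phi> has_field_derivative sin x - sin (x + s)) (at s within closed_segment 0 h)" for s
      by (auto intro!: derivative_eq_intros)
    show "norm (sin x - sin (x + s)) \<le> \<bar>h\<bar>" if "s \<in> closed_segment 0 h" for s
      using sin_lip[of s] that by (auto simp: closed_segment_eq_real_ivl abs_minus_commute split: if_splits)
  qed auto
  then show ?thesis
    by (simp add: power2_eq_square abs_mult algebra_simps)
qed

text \<open>Differentiation under the integral sign: the first-order error in \<open>t\<close> is uniformly quadratic,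
so it can be integrated directly.\<close>

lemma has_real_derivative_integral_cos:
  fixes A B p :: "'a \<Rightarrow> real"
  assumes "finite_measure M"
    and [measurable]: "A \<in> borel_measurable M" "B \<in> borel_measurable M" "p \<in> borel_measurable M"
    and B: "AE y in M. \<bar>B y\<bar> \<le> 1" and p: "AE y in M. \<bar>p y\<bar> \<le> 1"
  shows "((\<lambda>t. \<integral>y. p y * cos (A y + t * B y) \<partial>M) has_real_derivative
           - (\<integral>y. p y * B y * sin (A y + t * B y) \<partial>M)) (at t)"
proof -
  interpret finite_measure M by fact
  let ?D = "\<lambda>t. \<integral>y. p y * cos (A y + t * B y) \<partial>M"
  let ?L = "- (\<integral>y. p y * B y * sin (A y + t * B y) \<partial>M)"
  have int_cos: "integrable M (\<lambda>y. p y * cos (A y + t * B y))" for t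
    using p by (intro integrable_const_bound[of _ 1])
      (auto elim!: eventually_mono simp: abs_mult intro!: mult_le_one)
  have int_sin: "integrable M (\<lambda>y. p y * B y * sin (A y + t * B y))" for t
    using p B by (intro integrable_const_bound[of _ 1])
      (auto elim!: eventually_elim2 simp: abs_mult intro!: mult_le_one)
  define R where "R h y = p y * (cos (A y + t * B y + h * B y) - cos (A y + t * B y) + h * B y * sin (A y + t * B y))" for h y
  have R: "integrable M (R h)" "integral\<^sup>L M (R h) = ?D (t + h) - ?D t - h * ?L" for h
  proof -
    have R_eq: "R h = (\<lambda>y. p y * cos (A y + (t + h) * B y) - p y * cos (A y + t * B y) + h * (p y * B y * sin (A y + t * B y)))"
      by (simp add: R_def fun_eq_iff algebra_simps)
    show "integrable M (R h)" "integral\<^sup>L M (R h) = ?D (t + h) - ?D t - h * ?L"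
      unfolding R_eq using int_cos int_sin by (auto simp: Bochner_Integration.integral_diff Bochner_Integration.integral_add)
  qed
  have bound: "\<bar>?D (t + h) - ?D t - h * ?L\<bar> \<le> h\<^sup>2 * measure M (space M)" for h
  proof -
    have "AE y in M. norm (R h y) \<le> h\<^sup>2"
      using p B
    proof eventually_elim
      case (elim y)
      have "norm (R h y) \<le> 1 * (h * B y)\<^sup>2"
        unfolding R_def real_norm_def abs_mult using elim
        by (intro mult_mono cos_first_order_bound) auto
      also have "\<dots> \<le> h\<^sup>2 * 1"
        using elim by (simp add: power_mult_distrib abs_square_le_1 mult_left_le)
      finally show ?case by simp
    qed
    then have "(\<integral>y. norm (R h y) \<partial>M) \<le> (\<integral>y. h\<^sup>2 \<partial>M)"
      using R(1) by (intro integral_mono_AE) auto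
    then show ?thesis
      using integral_norm_bound[of M "R h"] by (simp add: R(2) mult.commute)
  qed
  have "((\<lambda>h. (?D (t + h) - ?D t) / h - ?L) \<longlongrightarrow> 0) (at 0)"
  proof (rule Lim_null_comparison)
    show "\<forall>\<^sub>F h in at 0. norm ((?D (t + h) - ?D t) / h - ?L) \<le> \<bar>h\<bar> * measure M (space M)"
      unfolding eventually_at_filter
    proof (intro always_eventually allI impI)
      fix h :: real assume "h \<noteq> 0"
      have "(a - b) / h - l = (a - b - h * l) / h" for a b l :: real
        using \<open>h \<noteq> 0\<close> by (simp add: field_simps)
      then have "norm ((?D (t + h) - ?D t) / h - ?L) = \<bar>?D (t + h) - ?D t - h * ?L\<bar> / \<bar>h\<bar>"
        by (simp only: real_norm_def abs_divide)
      also have "\<dots> \<le> h\<^sup>2 * measure M (space M) / \<bar>h\<bar>"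
        by (intro divide_right_mono bound) simp
      also have "\<dots> = \<bar>h\<bar> * measure M (space M)"
        using \<open>h \<noteq> 0\<close> by (cases "h > 0") (simp_all add: power2_eq_square)
      finally show "norm ((?D (t + h) - ?D t) / h - ?L) \<le> \<bar>h\<bar> * measure M (space M)" .
    qed
    show "((\<lambda>h. \<bar>h\<bar> * measure M (space M)) \<longlongrightarrow> 0) (at (0::real))"
      by (auto intro!: tendsto_eq_intros)
  qed
  then show ?thesis
    unfolding DERIV_def by (subst (asm) LIM_zero_iff)
qed

lemma has_real_derivative_integral_sin:
  fixes A B p :: "'a \<Rightarrow> real"
  assumes "finite_measure M"
    and [measurable]: "A \<in> borel_measurable M" "B \<in> borel_measurable M" "p \<in> borel_measurable M"
    and B: "AE y in M. \<bar>B y\<bar> \<le> 1" and p: "AE y in M. \<bar>p y\<bar> \<le> 1"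
  shows "((\<lambda>t. \<integral>y. p y * sin (A y + t * B y) \<partial>M) has_real_derivative
           (\<integral>y. p y * B y * cos (A y + t * B y) \<partial>M)) (at t)"
proof -
  (* The sine is the cosine with its phase shifted by a quarter period. *)
  have "cos (A y - pi/2 + t * B y) = sin (A y + t * B y)" "sin (A y - pi/2 + t * B y) = - cos (A y + t * B y)" for y t
    by (simp_all add: cos_add sin_add cos_diff sin_diff)
  then show ?thesis
    using has_real_derivative_integral_cos[OF assms(1) _ assms(3,4) B p, of "\<lambda>y. A y - pi/2" t] by simp
qed

lemma AE_coord_sphere_measure_inner_Basis:
  assumes "K \<subseteq> Basis" "b \<in> K"
  shows "AE y in coord_sphere_measure K. \<bar>y \<bullet> b\<bar> \<le> 1"
  using AE_coord_sphere_measure[OF assms(1)]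
proof eventually_elim
  case (elim y)
  then show ?case
    using Basis_le_norm[of b y] assms by (auto simp: coord_sphere_def)
qed

lemma integral_cos_coord_proj:
  assumes "K \<subseteq> Basis"
  shows "(\<integral>y. cos (u \<bullet> y) \<partial>coord_sphere_measure K) = (\<integral>y. cos (coord_proj K u \<bullet> y) \<partial>coord_sphere_measure K)"
proof (rule integral_cong_AE)
  show "AE y in coord_sphere_measure K. cos (u \<bullet> y) = cos (coord_proj K u \<bullet> y)"
    using AE_coord_sphere_measure[OF assms]
    by eventually_elim (simp add: coord_sphere_def coord_proj_inner_commute)
qed measurable

text \<open>The projections of \<open>u\<close> and \<open>v\<close> are exchanged by a reflection under which the measure is invariant.\<close>

lemma integral_cos_coord_sphere_radial:
  assumes K: "K \<subseteq> Basis" and "norm (coord_proj K u) = norm (coord_proj K v)"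
  shows "(\<integral>y. cos (u \<bullet> y) \<partial>coord_sphere_measure K) = (\<integral>y. cos (v \<bullet> y) \<partial>coord_sphere_measure K)"
proof -
  define w where "w = coord_proj K u - coord_proj K v"
  have w: "coord_proj K w = w"
    using linear_coord_proj[of K] K by (simp add: w_def linear_diff coord_proj_idem)
  have [measurable]: "householder w \<in> borel_measurable borel"
    unfolding householder_def by measurable
  have "(\<integral>y. cos (u \<bullet> y) \<partial>coord_sphere_measure K) = (\<integral>y. cos (coord_proj K u \<bullet> y) \<partial>coord_sphere_measure K)"
    by (rule integral_cos_coord_proj[OF K])
  also have "\<dots> = (\<integral>y. cos (coord_proj K u \<bullet> y) \<partial>(distr (coord_sphere_measure K) borel (householder w)))"
    by (subst coord_sphere_measure_invariant)
       (simp_all add: orthogonal_transformation_householder coord_proj_householder[OF w])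
  also have "\<dots> = (\<integral>y. cos (coord_proj K u \<bullet> householder w y) \<partial>coord_sphere_measure K)"
    by (subst integral_distr) auto
  also have "\<dots> = (\<integral>y. cos (coord_proj K v \<bullet> y) \<partial>coord_sphere_measure K)"
    unfolding householder_inner_commute[symmetric] w_def by (simp add: householder_swap[OF assms(2)])
  also have "\<dots> = (\<integral>y. cos (v \<bullet> y) \<partial>coord_sphere_measure K)"
    by (rule integral_cos_coord_proj[OF K, symmetric])
  finally show ?thesis .
qed

lemma integral_sin_coord_sphere: "(\<integral>y. sin (u \<bullet> y) \<partial>coord_sphere_measure K) = 0"
proof -
  have "(\<integral>y. sin (u \<bullet> y) \<partial>coord_sphere_measure K) = (\<integral>y. sin (u \<bullet> y) \<partial>(distr (coord_sphere_measure K) borel uminus))"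
    using linear_coord_proj[of K]
    by (subst coord_sphere_measure_invariant) (simp_all add: orthogonal_transformation_neg linear_neg)
  also have "\<dots> = - (\<integral>y. sin (u \<bullet> y) \<partial>coord_sphere_measure K)"
    by (subst integral_distr) auto
  finally show ?thesis by simp
qed

text \<open>The imaginary part vanishes because the measure is symmetric under \<open>y \<mapsto> -y\<close>.\<close>

lemma fourier_transform_coord_sphere_measure:
  "fourier_transform (coord_sphere_measure K) z
     = of_real (\<integral>y. cos (((2 * pi) *\<^sub>R z) \<bullet> y) \<partial>coord_sphere_measure K)"
proof -
  interpret finite_measure "coord_sphere_measure K"
    by (rule finite_measure_coord_sphere_measure)
  have "exp (- 2 * of_real pi * \<i> * of_real (z \<bullet> y)) 
      = complex_of_real (cos (((2 * pi) *\<^sub>R z) \<bullet> y)) - \<i> * complex_of_real (sin (((2 * pi) *\<^sub>R z) \<bullet> y))" for y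
  proof -
    have "- 2 * of_real pi * \<i> * of_real (z \<bullet> y) = - (\<i> * complex_of_real (((2 * pi) *\<^sub>R z) \<bullet> y))"
      by simp
    then show ?thesis
      by (simp only: exp_minus_Euler cos_of_real sin_of_real)
  qed
  moreover have "integrable (coord_sphere_measure K) (\<lambda>y. cos (((2 * pi) *\<^sub>R z) \<bullet> y))"
       "integrable (coord_sphere_measure K) (\<lambda>y. sin (((2 * pi) *\<^sub>R z) \<bullet> y))"
    by (auto intro!: integrable_const_bound[of _ 1])
  ultimately show ?thesis
    unfolding fourier_transform_def by (simp add: integral_sin_coord_sphere del: inner_scaleR_left)
qed

lemma coord_sphere_sum_squares:
  assumes "K \<subseteq> Basis" "y \<in> coord_sphere K"
  shows "(\<Sum>b\<in>K. (y \<bullet> b)\<^sup>2) = 1"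
proof -
  have "(\<Sum>b\<in>K. (y \<bullet> b)\<^sup>2) = (\<Sum>b\<in>Basis. (y \<bullet> b)\<^sup>2)"
    using assms by (intro sum.mono_neutral_left) (auto simp: coord_sphere_def coord_proj_eq_iff)
  also have "\<dots> = 1"
    using assms(2) euclidean_inner[of y y] dot_square_norm[of y] by (simp add: coord_sphere_def power2_eq_square)
  finally show ?thesis .
qed

text \<open>The transform \<open>u(z) = \<integral> cos (z \<bullet> y)\<close> depends on \<open>norm (coord_proj K z)\<close> only, so \<open>u(z) = f(norm (coord_proj K z))\<close>,
and since the measure lives on the unit sphere, applying the Laplacian multiplies \<open>u\<close> by \<open>-1\<close>. Hence \<open>f\<close>
solves \<open>f'' + (k - 1) f'/r + f = 0\<close> with \<open>k = card K\<close>, and \<open>bessel_decay\<close> applies. This replaces the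
usual stationary phase computation.

The equation is obtained pointwise at \<open>r b\<close> for a basis vector \<open>b\<close>: the second derivative in the
direction \<open>b\<close> is \<open>f''(r)\<close>, and the one in a direction \<open>c\<close> orthogonal to it is \<open>f'(r)/r\<close>, as one sees by
differentiating \<open>t \<mapsto> f(sqrt (r\<^sup>2 + t\<^sup>2))\<close> twice at \<open>0\<close>.\<close>

lemma integral_cos_coord_sphere_decay:
  fixes K :: "'a::euclidean_space set"
  assumes K: "K \<subseteq> Basis" "K \<noteq> {}"
  shows "\<exists>C\<ge>0. \<forall>z. \<forall>\<tau>\<in>{0..real (card K) - 1}. coord_proj K z \<noteq> 0 \<longrightarrow>
     (\<integral>y. cos (z \<bullet> y) \<partial>coord_sphere_measure K)\<^sup>2 \<le> C * norm (coord_proj K z) powr (-\<tau>)"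
proof -
  interpret finite_measure "coord_sphere_measure K"
    by (rule finite_measure_coord_sphere_measure)
  let ?\<sigma> = "coord_sphere_measure K"
  have fin: "finite K"
    using finite_subset[OF K(1) finite_Basis] .
  obtain b where b: "b \<in> K" using K by blast
  note AEb = AE_coord_sphere_measure_inner_Basis[OF K(1)]
  define f where "f r = (\<integral>y. cos (r * (y \<bullet> b)) \<partial>?\<sigma>)" for r
  define f1 where "f1 r = - (\<integral>y. (y \<bullet> b) * sin (r * (y \<bullet> b)) \<partial>?\<sigma>)" for r
  define f2 where "f2 r = - (\<integral>y. (y \<bullet> b)\<^sup>2 * cos (r * (y \<bullet> b)) \<partial>?\<sigma>)" for r
  have df: "(f has_real_derivative f1 r) (at r)" for r
    using has_real_derivative_integral_cos[of ?\<sigma> "\<lambda>_. 0" "\<lambda>y. y \<bullet> b" "\<lambda>_. 1" r] AEb[OF b]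
    by (simp add: finite_measure_axioms f_def[abs_def] f1_def)
  have df1: "(f1 has_real_derivative f2 r) (at r)" for r
    unfolding f1_def[abs_def] f2_def
    using has_real_derivative_integral_sin[of ?\<sigma> "\<lambda>_. 0" "\<lambda>y. y \<bullet> b" "\<lambda>y. y \<bullet> b" r] AEb[OF b]
    by (intro DERIV_minus) (simp add: finite_measure_axioms power2_eq_square)
  have trans: "(\<integral>y. cos (z \<bullet> y) \<partial>?\<sigma>) = f (norm (coord_proj K z))" for z
  proof -
    have "norm (coord_proj K (norm (coord_proj K z) *\<^sub>R b)) = norm (coord_proj K z)"
      using linear_coord_proj[of K] b K(1) by (auto simp: linear_scale coord_proj_Basis)
    from integral_cos_coord_sphere_radial[OF K(1) this[symmetric]] show ?thesis
      by (simp add: f_def inner_commute)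
  qed
  (* The second derivative of u at r b in a direction c orthogonal to b, with the sign reversed. *)
  have transverse: "(\<integral>y. (y \<bullet> c)\<^sup>2 * cos (r * (y \<bullet> b)) \<partial>?\<sigma>) = - f1 r / r"
    if c: "c \<in> K - {b}" and r: "r > 0" for c r
  proof -
    let ?\<rho> = "\<lambda>t. sqrt (r\<^sup>2 + t\<^sup>2)"
    have pos: "r\<^sup>2 + t\<^sup>2 > 0" for t
      using r by (simp add: add_pos_nonneg)
    have eq: "(\<integral>y. 1 * cos (r * (y \<bullet> b) + t * (y \<bullet> c)) \<partial>?\<sigma>) = f (?\<rho> t)" for t
    proof -
      let ?z = "r *\<^sub>R b + t *\<^sub>R c"
      have "coord_proj K ?z = ?z"
        using linear_coord_proj[of K] b c K(1) by (simp add: linear_scale linear_add coord_proj_Basis)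
      moreover have "norm ?z = ?\<rho> t"
      proof -
        have "b \<bullet> b = 1" "c \<bullet> c = 1" "b \<bullet> c = 0" "c \<bullet> b = 0"
          using b c K(1) by (auto simp: inner_same_Basis intro!: inner_not_same_Basis)
        then have "?z \<bullet> ?z = r\<^sup>2 + t\<^sup>2"
          by (simp add: inner_add_left inner_add_right power2_eq_square)
        then show ?thesis by (simp add: norm_eq_sqrt_inner)
      qed
      moreover have "?z \<bullet> y = r * (y \<bullet> b) + t * (y \<bullet> c)" for y
        by (simp add: inner_add_left inner_commute[of y])
      ultimately show ?thesis
        using trans[of ?z] by simp
    qed
    have first: "- (\<integral>y. 1 * (y \<bullet> c) * sin (r * (y \<bullet> b) + t * (y \<bullet> c)) \<partial>?\<sigma>) = t * (f1 (?\<rho> t) / ?\<rho> t)" for t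
    proof (rule DERIV_unique)
      show "((\<lambda>t. f (?\<rho> t)) has_real_derivative - (\<integral>y. 1 * (y \<bullet> c) * sin (r * (y \<bullet> b) + t * (y \<bullet> c)) \<partial>?\<sigma>)) (at t)"
        unfolding eq[symmetric] using AEb[of c] c
        by (intro has_real_derivative_integral_cos finite_measure_axioms) auto
      show "((\<lambda>t. f (?\<rho> t)) has_real_derivative t * (f1 (?\<rho> t) / ?\<rho> t)) (at t)"
        by (rule DERIV_chain2[OF df, THEN DERIV_cong])
           (use pos[of t] in \<open>auto intro!: derivative_eq_intros simp: field_simps\<close>)
    qed
    have "- (\<integral>y. (y \<bullet> c) * (y \<bullet> c) * cos (r * (y \<bullet> b) + 0 * (y \<bullet> c)) \<partial>?\<sigma>) = f1 r / r"
    proof (rule DERIV_unique)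
      show "((\<lambda>t. t * (f1 (?\<rho> t) / ?\<rho> t)) has_real_derivative 
          - (\<integral>y. (y \<bullet> c) * (y \<bullet> c) * cos (r * (y \<bullet> b) + 0 * (y \<bullet> c)) \<partial>?\<sigma>)) (at 0)"
        unfolding first[symmetric] mult_1 using AEb[of c] c
        by (intro DERIV_minus has_real_derivative_integral_sin finite_measure_axioms) auto
      have "((\<lambda>t. f1 (?\<rho> t) / ?\<rho> t) has_real_derivative 
         (f2 (?\<rho> 0) * 0 * ?\<rho> 0 - f1 (?\<rho> 0) * 0) / (?\<rho> 0 * ?\<rho> 0)) (at 0)"
        using r by (intro DERIV_divide DERIV_chain2[OF df1]) (auto intro!: derivative_eq_intros)
      from DERIV_mult'[OF DERIV_ident this] show "((\<lambda>t. t * (f1 (?\<rho> t) / ?\<rho> t)) has_real_derivative f1 r / r) (at 0)"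
        using r by simp
    qed
    then show ?thesis
      by (simp add: power2_eq_square)
  qed
  have int_sq: "integrable ?\<sigma> (\<lambda>y. (y \<bullet> c)\<^sup>2 * cos (r * (y \<bullet> b)))" if "c \<in> K" for c r
    using AEb[OF that] by (intro integrable_const_bound[of _ 1])
       (auto elim!: eventually_mono simp: abs_mult abs_square_le_1 intro!: mult_le_one)
  (* On the sphere the squares of the coordinates sum to 1, so f splits into second derivatives of u. *)
  have ode: "f r + f2 r = - real (card K - 1) * (f1 r / r)" if "r > 0" for r
  proof -
    have "f r = (\<integral>y. (\<Sum>c\<in>K. (y \<bullet> c)\<^sup>2 * cos (r * (y \<bullet> b))) \<partial>?\<sigma>)"
      unfolding f_def
    proof (rule integral_cong_AE)
      show "AE y in ?\<sigma>. cos (r * (y \<bullet> b)) = (\<Sum>c\<in>K. (y \<bullet> c)\<^sup>2 * cos (r * (y \<bullet> b)))"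
        using AE_coord_sphere_measure[OF K(1)]
        by eventually_elim (simp add: sum_distrib_right[symmetric] coord_sphere_sum_squares[OF K(1)])
    qed measurable
    also have "\<dots> = (\<Sum>c\<in>K. \<integral>y. (y \<bullet> c)\<^sup>2 * cos (r * (y \<bullet> b)) \<partial>?\<sigma>)"
      by (intro Bochner_Integration.integral_sum int_sq)
    also have "\<dots> = - f2 r + (\<Sum>c\<in>K - {b}. \<integral>y. (y \<bullet> c)\<^sup>2 * cos (r * (y \<bullet> b)) \<partial>?\<sigma>)"
      using fin b by (subst sum.remove[of _ b]) (auto simp: f2_def)
    also have "(\<Sum>c\<in>K - {b}. \<integral>y. (y \<bullet> c)\<^sup>2 * cos (r * (y \<bullet> b)) \<partial>?\<sigma>) = (\<Sum>c\<in>K - {b}. - f1 r / r)"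
      by (intro sum.cong refl transverse that)
    also have "\<dots> = - real (card K - 1) * (f1 r / r)"
      using fin b by simp
    finally show ?thesis by simp
  qed
  have bounded: "\<bar>f r\<bar> \<le> measure ?\<sigma> UNIV" for r
  proof -
    have "norm (f r) \<le> (\<integral>y. norm (cos (r * (y \<bullet> b))) \<partial>?\<sigma>)"
      unfolding f_def by (rule integral_norm_bound)
    also have "\<dots> \<le> (\<integral>y. 1 \<partial>?\<sigma>)"
      by (intro integral_mono_AE integrable_const_bound[of _ 1]) auto
    finally show ?thesis by simp
  qed
  obtain C where C: "C \<ge> 0" "\<And>r \<tau>. r > 0 \<Longrightarrow> \<tau> \<in> {0..real (card K - 1)} \<Longrightarrow> (f r)\<^sup>2 \<le> C * r powr (-\<tau>)"
    using bessel_decay[of f f1 f2 "card K - 1" "measure ?\<sigma> UNIV"] df df1 ode bounded by blast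
  have "card K > 0"
    using fin b by (auto simp: card_gt_0_iff)
  then have "real (card K - 1) = real (card K) - 1"
    by simp
  with C show ?thesis
    unfolding trans by (intro exI[of _ C]) auto
qed

section \<open>Finite energy of the sphere measure\<close>

text \<open>A function of one variable that behaves like \<open>1/\<bar>t\<bar>\<close> up to an exponent \<open>\<epsilon>\<close> that makes it integrable both at
the origin and at infinity.\<close>

definition balanced_power :: "real \<Rightarrow> real \<Rightarrow> real" where
  "balanced_power \<epsilon> t = \<bar>t\<bar> powr - (if \<bar>t\<bar> \<le> 1 then 1 - \<epsilon> else 1 + \<epsilon>)"

lemma borel_measurable_balanced_power [measurable]: "balanced_power \<epsilon> \<in> borel_measurable borel"
  unfolding balanced_power_def[abs_def] by measurable

lemma nn_integral_balanced_power_finite: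
  assumes "0 < \<epsilon>" 
  shows "(\<integral>\<^sup>+t. ennreal (balanced_power \<epsilon> t) \<partial>lborel) < \<infinity>"
proof -
  define u where "u t = (if t \<in> {0..1} then t powr (\<epsilon> - 1) else 0) + (if t \<in> {1..} then t powr (- 1 - \<epsilon>) else 0)" for t :: real
  have [measurable]: "u \<in> borel_measurable borel"
    unfolding u_def[abs_def] by measurable
  have u_nonneg: "u t \<ge> 0" for t by (simp add: u_def)
  have near: "((\<lambda>t. t powr (\<epsilon> - 1)) has_integral (1 powr (\<epsilon> - 1 + 1) / (\<epsilon> - 1 + 1))) {0..1}"
    using assms by (intro has_integral_powr_from_0) auto
  have far: "((\<lambda>t. t powr (- 1 - \<epsilon>)) has_integral - (1 powr (- 1 - \<epsilon> + 1)) / (- 1 - \<epsilon> + 1)) {1..}"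
    using assms by (intro has_integral_powr_to_inf) auto
  obtain I where "(u has_integral I) UNIV"
    unfolding u_def[abs_def]
    using has_integral_add[OF near[THEN has_integral_restrict_UNIV[THEN iffD2]]
        far[THEN has_integral_restrict_UNIV[THEN iffD2]]] by blast
  then have I: "(\<integral>\<^sup>+t. ennreal (u t) \<partial>lborel) = ennreal I"
    using u_nonneg by (intro nn_integral_has_integral_lborel) auto
  have "(\<integral>\<^sup>+t. ennreal (u t) \<partial>lborel) = (\<integral>\<^sup>+t. ennreal (u t) \<partial>distr lborel borel uminus)"
    by (simp add: lborel_distr_uminus)
  also have "\<dots> = (\<integral>\<^sup>+t. ennreal (u (- t)) \<partial>lborel)"
    by (subst nn_integral_distr) auto
  finally have I': "(\<integral>\<^sup>+t. ennreal (u (- t)) \<partial>lborel) = ennreal I"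
    using I by simp
  have "balanced_power \<epsilon> t \<le> u t + u (- t)" for t
    by (cases "t \<ge> 0") (auto simp: balanced_power_def u_def)
  then have "(\<integral>\<^sup>+t. ennreal (balanced_power \<epsilon> t) \<partial>lborel) \<le> (\<integral>\<^sup>+t. ennreal (u t) + ennreal (u (- t)) \<partial>lborel)"
    using u_nonneg by (intro nn_integral_mono) (simp flip: ennreal_plus)
  also have "\<dots> = ennreal I + ennreal I"
    by (subst nn_integral_add) (auto simp: I I')
  finally show ?thesis
    by (simp add: order.strict_trans1)
qed

text \<open>Each coordinate receives its own exponent \<open>e b\<close>. For a coordinate outside \<open>K\<close> the factor
\<open>\<bar>z \<bullet> b\<bar> powr - e b\<close> is split off \<open>norm z powr - p\<close>; what remains of that power is estimated through
\<open>norm (coord_proj K z) \<le> norm z\<close>, and the total power of \<open>norm (coord_proj K z)\<close> is then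
exactly enough for the coordinates in \<open>K\<close>.\<close>

lemma norm_powr_le_prod:
  fixes z :: "'a::euclidean_space"
  assumes K: "K \<subseteq> Basis" "K \<noteq> {}" and z: "\<And>b. b \<in> Basis \<Longrightarrow> z \<bullet> b \<noteq> 0"
    and e: "\<And>b. b \<in> Basis \<Longrightarrow> 0 \<le> e b" and p: "(\<Sum>b\<in>Basis - K. e b) \<le> p"
  shows "norm (coord_proj K z) powr - ((\<Sum>b\<in>Basis. e b) - p) * norm z powr - p
      \<le> (\<Prod>b\<in>Basis. \<bar>z \<bullet> b\<bar> powr - e b)"
proof -
  define A where "A = (\<Sum>b\<in>Basis - K. e b)"
  define B where "B = (\<Sum>b\<in>K. e b)"
  have fin: "finite K"
    using finite_subset[OF K(1) finite_Basis] .
  have AB: "(\<Sum>b\<in>Basis. e b) = A + B"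
    unfolding A_def B_def by (rule sum.subset_diff[OF K(1) finite_Basis])
  have comp: "\<bar>z \<bullet> b\<bar> \<le> norm (coord_proj K z)" if "b \<in> K" for b
    using Basis_le_norm[of b "coord_proj K z"] that K(1) by (auto simp: coord_proj_inner_Basis subset_iff)
  obtain b0 where "b0 \<in> K" using K by blast
  then have pos: "norm (coord_proj K z) > 0"
    using comp[of b0] z[of b0] K(1) by auto
  then have posz: "norm z > 0"
    using norm_coord_proj_le[OF K(1), of z] by linarith
  have out: "norm z powr - A \<le> (\<Prod>b\<in>Basis - K. \<bar>z \<bullet> b\<bar> powr - e b)"
  proof -
    have "norm z powr - A = (\<Prod>b\<in>Basis - K. norm z powr - e b)"
      using posz unfolding A_def sum_negf[symmetric] by (intro powr_sum) auto
    also have "\<dots> \<le> (\<Prod>b\<in>Basis - K. \<bar>z \<bullet> b\<bar> powr - e b)"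
      using z e Basis_le_norm by (intro prod_mono) (auto intro!: powr_mono2')
    finally show ?thesis .
  qed
  have ins: "norm (coord_proj K z) powr - B \<le> (\<Prod>b\<in>K. \<bar>z \<bullet> b\<bar> powr - e b)"
  proof -
    have "norm (coord_proj K z) powr - B = (\<Prod>b\<in>K. norm (coord_proj K z) powr - e b)"
      using pos fin unfolding B_def sum_negf[symmetric] by (intro powr_sum) auto
    also have "\<dots> \<le> (\<Prod>b\<in>K. \<bar>z \<bullet> b\<bar> powr - e b)"
      using z e comp K(1) by (intro prod_mono) (auto intro!: powr_mono2')
    finally show ?thesis .
  qed
  have "norm (coord_proj K z) powr - (A + B - p) * norm z powr - p
      = norm (coord_proj K z) powr - (A + B - p) * (norm z powr - (p - A) * norm z powr - A)"
    by (simp add: powr_add[symmetric])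
  also have "\<dots> \<le> norm (coord_proj K z) powr - (A + B - p) * (norm (coord_proj K z) powr - (p - A) * norm z powr - A)"
    using pos p norm_coord_proj_le[OF K(1), of z]
    by (intro mult_left_mono mult_right_mono powr_mono2') (auto simp: A_def)
  also have "\<dots> = norm (coord_proj K z) powr - B * norm z powr - A"
    unfolding mult.assoc[symmetric] by (simp add: powr_add[symmetric])
  also have "\<dots> \<le> (\<Prod>b\<in>K. \<bar>z \<bullet> b\<bar> powr - e b) * (\<Prod>b\<in>Basis - K. \<bar>z \<bullet> b\<bar> powr - e b)"
    by (intro mult_mono ins out prod_nonneg) auto
  also have "\<dots> = (\<Prod>b\<in>Basis. \<bar>z \<bullet> b\<bar> powr - e b)"
    by (subst prod.subset_diff[OF K(1) finite_Basis]) (simp add: mult.commute)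
  finally show ?thesis
    by (simp add: AB)
qed

lemma AE_lborel_inner_Basis_nonzero: "AE z in lborel. \<forall>b\<in>Basis. (z::'a::euclidean_space) \<bullet> b \<noteq> 0"
proof (rule AE_finite_allI[OF finite_Basis])
  fix b :: 'a assume b: "b \<in> Basis"
  have "negligible {x. b \<bullet> x = 0}"
    using b by (intro negligible_hyperplane) auto
  then have "{x. b \<bullet> x = 0} \<in> null_sets lborel"
    by (subst null_sets_completion_iff[symmetric]) (auto simp: negligible_iff_null_sets closed_hyperplane)
  then have "AE z in lborel. z \<notin> {x. b \<bullet> x = 0}"
    by (rule AE_not_in)
  then show "AE z in lborel. z \<bullet> b \<noteq> 0"
    by eventually_elim (simp add: inner_commute)
qed

text \<open>Write \<open>p = DIM('a) - s/\<theta>\<close>. Up to a constant the integrand is at most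
\<open>norm (coord_proj K z) powr - \<tau> * norm z powr - p\<close> for every \<open>\<tau>\<close> between \<open>0\<close> and \<open>(k - 1)/\<theta>\<close>. At a given
\<open>z\<close> the exponents \<open>e z b\<close> are taken as \<open>1 - \<epsilon>\<close> for small and \<open>1 + \<epsilon>\<close> for large coordinates, and \<open>\<tau>\<close> is
the number that makes the two sides homogeneous of the same degree. Then the integrand is dominated by a
product of integrable functions of one variable, and Tonelli's theorem applies. The value \<open>\<tau>\<close> is close to
\<open>s/\<theta>\<close>, so it is admissible for small \<open>\<epsilon>\<close> because \<open>0 < s < k - 1\<close>; the condition \<open>s < \<theta> k\<close> says that \<open>p\<close>
exceeds the number of coordinates outside \<open>K\<close>.\<close>

lemma fourier_energy_coord_sphere_measure_finite:
  fixes K :: "'a::euclidean_space set"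
  assumes K: "K \<subseteq> Basis" "K \<noteq> {}" and \<theta>: "0 < \<theta>" 
    and s: "0 < s" "s < \<theta> * real (card K)" "s < real (card K) - 1"
  shows "fourier_energy s \<theta> (coord_sphere_measure K) < \<infinity>"
proof -
  define d k where "d = real DIM('a)" and "k = real (card K)"
  define p where "p = d - s / \<theta>"
  have "k \<le> d"
    using card_mono[OF finite_Basis K(1)] by (simp add: d_def k_def)
  have "d \<ge> 1"
    using DIM_positive[where 'a='a] by (simp add: d_def Suc_leI)
  have "p < d" "d - k < p" "d - p < (k - 1) / \<theta>"
    using \<theta> s by (auto simp: p_def k_def field_simps)
  (* The total change of the exponents over all coordinates, at most the slack in each condition. *)
  define \<delta> where "\<delta> = min (1/2) (min (d - p) (min (p - (d - k)) ((k - 1) / \<theta> - (d - p))))"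
  define \<epsilon> where "\<epsilon> = \<delta> / d"
  have \<delta>: "0 < \<delta>" "\<delta> \<le> d - p" "\<delta> \<le> p - (d - k)" "\<delta> \<le> (k - 1) / \<theta> - (d - p)"
    using \<open>p < d\<close> \<open>d - k < p\<close> \<open>d - p < (k - 1) / \<theta>\<close> by (auto simp: \<delta>_def)
  have "\<delta> \<le> 1/2"
    unfolding \<delta>_def by (rule min.cobounded1)
  have \<epsilon>: "0 < \<epsilon>" "\<epsilon> < 1" "d * \<epsilon> = \<delta>"
    using \<delta>(1) \<open>\<delta> \<le> 1/2\<close> \<open>d \<ge> 1\<close> by (auto simp: \<epsilon>_def divide_less_eq)
  define e where "e z b = (if \<bar>z \<bullet> b\<bar> \<le> 1 then 1 - \<epsilon> else 1 + \<epsilon>)" for z b :: 'a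
  have e_nonneg: "e z b \<ge> 0" for z b
    using \<epsilon> by (simp add: e_def)
  have e_upper: "(\<Sum>b\<in>Basis - K. e z b) \<le> p" for z
  proof -
    have "(\<Sum>b\<in>Basis - K. e z b) \<le> real (card (Basis - K)) * (1 + \<epsilon>)"
      using \<epsilon> by (intro sum_bounded_above) (auto simp: e_def)
    also have "real (card (Basis - K)) = d - k"
      using K(1) card_mono[OF finite_Basis K(1)] finite_subset[OF K(1) finite_Basis] by (simp add: card_Diff_subset d_def k_def of_nat_diff)
    also have "(d - k) * (1 + \<epsilon>) \<le> d - k + \<delta>"
      unfolding \<epsilon>(3)[symmetric] using \<epsilon> by (simp add: algebra_simps k_def)
    also have "\<dots> \<le> p"
      using \<delta> by simp
    finally show ?thesis .
  qed
  have sum_e: "0 \<le> (\<Sum>b\<in>Basis. e z b) - p" "(\<Sum>b\<in>Basis. e z b) - p \<le> (k - 1) / \<theta>" for z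
  proof -
    have "(\<Sum>b\<in>Basis. e z b) \<ge> real (card (Basis::'a set)) * (1 - \<epsilon>)"
      using \<epsilon> by (intro sum_bounded_below) (auto simp: e_def)
    moreover have "(\<Sum>b\<in>Basis. e z b) \<le> real (card (Basis::'a set)) * (1 + \<epsilon>)"
      using \<epsilon> by (intro sum_bounded_above) (auto simp: e_def)
    ultimately show "0 \<le> (\<Sum>b\<in>Basis. e z b) - p" "(\<Sum>b\<in>Basis. e z b) - p \<le> (k - 1) / \<theta>"
      using \<delta> \<epsilon>(3) by (auto simp: d_def algebra_simps)
  qed
  let ?F = "fourier_transform (coord_sphere_measure K)"
  obtain C where C: "C \<ge> 0" "\<And>z \<tau>. \<tau> \<in> {0..k - 1} \<Longrightarrow> coord_proj K z \<noteq> 0 \<Longrightarrow>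
     (\<integral>y. cos (z \<bullet> y) \<partial>coord_sphere_measure K)\<^sup>2 \<le> C * norm (coord_proj K z) powr (-\<tau>)"
    using integral_cos_coord_sphere_decay[OF K] unfolding k_def by blast
  have F: "norm (?F z) powr (2 / \<theta>) \<le> C powr (1 / \<theta>) * norm (coord_proj K z) powr - \<tau>"
    if "coord_proj K z \<noteq> 0" "0 \<le> \<tau>" "\<tau> \<le> (k - 1) / \<theta>" for z \<tau>
  proof -
    let ?r = "norm (coord_proj K z)"
    have r: "norm (coord_proj K ((2 * pi) *\<^sub>R z)) = 2 * pi * ?r"
      using linear_coord_proj[of K] by (simp add: linear_scale)
    have eq: "norm (?F z) powr (2 / \<theta>) = ((norm (?F z))\<^sup>2) powr (1 / \<theta>)"
      by (cases "?F z = 0") (auto simp: powr_powr simp flip: powr_numeral)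
    have "(norm (?F z))\<^sup>2 \<le> C * (2 * pi * ?r) powr (- (\<theta> * \<tau>))"
      using C(2)[of "\<theta> * \<tau>" "(2 * pi) *\<^sub>R z"] that \<theta> linear_coord_proj[of K]
      unfolding fourier_transform_coord_sphere_measure r
      by (simp add: linear_scale field_simps del: inner_scaleR_left)
    also have "\<dots> \<le> C * ?r powr (- (\<theta> * \<tau>))"
    proof (intro mult_left_mono powr_mono2')
      (* The factor 2 pi from the normalisation of the transform exceeds 1 and only helps. *)
      show "?r \<le> 2 * pi * ?r"
        using pi_ge_two by (intro mult_right_mono[of 1 "2 * pi", simplified]) auto
    qed (use that \<theta> C(1) in auto)
    finally have "((norm (?F z))\<^sup>2) powr (1 / \<theta>) \<le> (C * ?r powr (- (\<theta> * \<tau>))) powr (1 / \<theta>)"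
      using \<theta> by (intro powr_mono2) auto
    also have "\<dots> = C powr (1 / \<theta>) * ?r powr - \<tau>"
      using \<theta> C(1) by (simp add: powr_mult powr_powr)
    finally show ?thesis
      unfolding eq .
  qed
  define I where "I = (\<integral>\<^sup>+ z. ennreal (norm (?F z) powr (2 / \<theta>) * norm z powr (s / \<theta> - real DIM('a))) \<partial>lborel)"
  have "I \<le> (\<integral>\<^sup>+ z. ennreal (C powr (1 / \<theta>)) * (\<Prod>b\<in>(Basis::'a set). ennreal (balanced_power \<epsilon> (z \<bullet> b))) \<partial>lborel)"
    unfolding I_def
  proof (rule nn_integral_mono_AE)
    show "AE z in lborel. ennreal (norm (?F z) powr (2 / \<theta>) * norm z powr (s / \<theta> - real DIM('a)))
        \<le> ennreal (C powr (1 / \<theta>)) * (\<Prod>b\<in>Basis. ennreal (balanced_power \<epsilon> (z \<bullet> b)))"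
      using AE_lborel_inner_Basis_nonzero
    proof eventually_elim
      case (elim z)
      obtain b where "b \<in> K" using K by blast
      then have "coord_proj K z \<noteq> 0"
        using elim K(1) coord_proj_inner_Basis[OF K(1), of b z] by auto
      let ?\<tau> = "(\<Sum>b\<in>Basis. e z b) - p"
      have "norm (?F z) powr (2 / \<theta>) * norm z powr (s / \<theta> - real DIM('a))
         \<le> (C powr (1 / \<theta>) * norm (coord_proj K z) powr - ?\<tau>) * norm z powr - p"
        using F[OF \<open>coord_proj K z \<noteq> 0\<close> sum_e] unfolding p_def d_def by (auto intro!: mult_right_mono)
      also have "\<dots> = C powr (1 / \<theta>) * (norm (coord_proj K z) powr - ?\<tau> * norm z powr - p)"
        by simp
      also have "\<dots> \<le> C powr (1 / \<theta>) * (\<Prod>b\<in>Basis. \<bar>z \<bullet> b\<bar> powr - e z b)"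
        using elim by (intro mult_left_mono norm_powr_le_prod K e_upper e_nonneg) auto
      also have "\<dots> = C powr (1 / \<theta>) * (\<Prod>b\<in>Basis. balanced_power \<epsilon> (z \<bullet> b))"
        by (simp add: balanced_power_def e_def)
      finally have "ennreal (norm (?F z) powr (2 / \<theta>) * norm z powr (s / \<theta> - real DIM('a)))
        \<le> ennreal (C powr (1 / \<theta>) * (\<Prod>b\<in>Basis. balanced_power \<epsilon> (z \<bullet> b)))"
        by (rule ennreal_leI)
      also have "\<dots> = ennreal (C powr (1 / \<theta>)) * (\<Prod>b\<in>Basis. ennreal (balanced_power \<epsilon> (z \<bullet> b)))"
        by (subst ennreal_mult) (auto simp: prod_ennreal balanced_power_def intro!: prod_nonneg)
      finally show ?case .
    qed
  qed
  also have "\<dots> = ennreal (C powr (1 / \<theta>)) * (\<Prod>b\<in>(Basis::'a set). (\<integral>\<^sup>+ t. ennreal (balanced_power \<epsilon> t) \<partial>lborel))"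
    by (subst nn_integral_cmult, measurable, subst nn_integral_lborel_prod) auto
  also have "\<dots> < \<infinity>"
    using nn_integral_balanced_power_finite[OF \<epsilon>(1)] by (simp add: ennreal_mult_less_top power_less_top_ennreal)
  finally have "I < \<infinity>" .
  then show ?thesis
    using \<theta> unfolding fourier_energy_def Let_def I_def[symmetric] by simp
qed

section \<open>Infinite energy at the exponent one half\<close>

text \<open>The complement of the support is a union of open null sets, and by Lindelof's theorem countably many
of them suffice.\<close>

lemma AE_in_closed_of_measure_support_subset:
  fixes \<mu> :: "'a::second_countable_topology measure"
  assumes "sets \<mu> = sets borel" "measure_support \<mu> \<subseteq> E"
  shows "AE y in \<mu>. y \<in> E"
proof -
  define \<F> where "\<F> = {U. open U \<and> emeasure \<mu> U = 0}"
  obtain \<F>' where F': "\<F>' \<subseteq> \<F>" "countable \<F>'" "\<Union>\<F>' = \<Union>\<F>"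
    using Lindelof[of \<F>] by (auto simp: \<F>_def)
  have "(\<Union>U\<in>\<F>'. U) \<in> null_sets \<mu>"
    using F'(1,2) assms(1) by (intro null_sets_UN') (auto simp: \<F>_def null_sets_def)
  moreover have "- E \<subseteq> \<Union>\<F>"
  proof
    fix x assume "x \<in> - E"
    then have "x \<notin> measure_support \<mu>"
      using assms(2) by blast
    then obtain U where "open U" "x \<in> U" "\<not> emeasure \<mu> U > 0"
      unfolding measure_support_def by blast
    then show "x \<in> \<Union>\<F>"
      by (auto simp: \<F>_def)
  qed
  ultimately show ?thesis
    using F'(3) by (intro AE_I'[of "\<Union>\<F>'"]) auto
qed

text \<open>For \<open>y\<close> on the coordinate sphere \<open>\<bar>z \<bullet> y\<bar> \<le> norm (coord_proj K z)\<close>, so the phase is at most \<open>pi/3\<close>, where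
the cosine is at least \<open>1/2\<close>. The bound holds on a whole slab: the transform does not decay in the
directions orthogonal to the sphere.\<close>

lemma norm_fourier_transform_ge_half_mass:
  assumes K: "K \<subseteq> Basis" and \<mu>: "finite_measure \<mu>" "sets \<mu> = sets borel" "AE y in \<mu>. y \<in> coord_sphere K"
    and z: "norm (coord_proj K z) \<le> 1 / 6"
  shows "measure \<mu> UNIV / 2 \<le> norm (fourier_transform \<mu> z)"
proof -
  interpret finite_measure \<mu> by fact
  have [simp]: "space \<mu> = UNIV"
    using sets_eq_imp_space_eq[OF \<mu>(2)] by simp
  note [measurable_cong] = \<mu>(2)
  let ?f = "\<lambda>y. exp (- 2 * of_real pi * \<i> * of_real (z \<bullet> y))"
  have int: "integrable \<mu> ?f"
    by (intro integrable_const_bound[of _ 1]) (auto simp: norm_exp_eq_Re)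
  have "AE y in \<mu>. 1 / 2 \<le> Re (?f y)"
    using \<mu>(3)
  proof eventually_elim
    case (elim y)
    have "\<bar>z \<bullet> y\<bar> = \<bar>coord_proj K z \<bullet> y\<bar>"
      using elim by (simp add: coord_sphere_def coord_proj_inner_commute)
    also have "\<dots> \<le> 1 / 6"
      using Cauchy_Schwarz_ineq2[of "coord_proj K z" y] elim z by (simp add: coord_sphere_def)
    finally have "cos (pi / 3) \<le> cos \<bar>2 * pi * (z \<bullet> y)\<bar>"
      by (intro cos_monotone_0_pi_le) (auto simp: abs_mult)
    then have "1 / 2 \<le> cos (2 * pi * (z \<bullet> y))"
      by (simp only: cos_abs_real cos_60)
    then show ?case
      by (simp add: Re_exp)
  qed
  then have "(\<integral>y. 1 / 2 \<partial>\<mu>) \<le> (\<integral>y. Re (?f y) \<partial>\<mu>)"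
    using int by (intro integral_mono_AE) auto
  also have "\<dots> = Re (fourier_transform \<mu> z)"
    unfolding fourier_transform_def using int by (rule integral_Re)
  also have "\<dots> \<le> norm (fourier_transform \<mu> z)"
    by (rule complex_Re_le_cmod)
  finally show ?thesis by simp
qed

text \<open>The integrand is at least a multiple of \<open>norm z powr (2 s - d)\<close> on the slab from
\<open>norm_fourier_transform_ge_half_mass\<close>. A box in the slab of side \<open>R\<close> in the \<open>d - k\<close> free directions,
at distance about \<open>R\<close> from the origin, contributes a multiple of \<open>R powr (2 s - k)\<close>, which is
unbounded in \<open>R\<close> when \<open>s > k/2\<close>.\<close>

lemma fourier_energy_half_eq_infinity:
  fixes K :: "'a::euclidean_space set"
  assumes K: "K \<subset> Basis" and \<mu>: "\<mu> \<in> finite_borel_measures_on (coord_sphere K)"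
    and s: "real (card K) / 2 < s"
  shows "fourier_energy s (1 / 2) \<mu> = \<infinity>"
proof -
  define d k q where "d = real DIM('a)" and "k = card K" and "q = 2 * s - d"
  define m where "m = measure \<mu> UNIV"
  (* d coordinates of size at most 1/(6 d) keep the projection within norm 1/6. *)
  define \<eta> where "\<eta> = 1 / (6 * d)"
  define c where "c = (m / 2) ^ 4 * min 1 ((2 * d) powr q) * \<eta> ^ k"
  define I where "I = (\<integral>\<^sup>+ z. ennreal (norm (fourier_transform \<mu> z) powr (2 / (1 / 2)) * norm z powr (s / (1 / 2) - real DIM('a))) \<partial>lborel)"
  have K': "K \<subseteq> Basis" using K by blast
  have sets: "sets \<mu> = sets borel" and fin: "finite_measure \<mu>" and nz: "emeasure \<mu> UNIV \<noteq> 0"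
    and AE: "AE y in \<mu>. y \<in> coord_sphere K"
    using \<mu> AE_in_closed_of_measure_support_subset[of \<mu>] by (auto simp: finite_borel_measures_on_def)
  have "m > 0"
    using nz finite_measure.emeasure_eq_measure[OF fin, of UNIV] by (simp add: m_def zero_less_measure_iff)
  have d1: "d \<ge> 1"
    using DIM_positive[where 'a='a] by (simp add: d_def Suc_leI)
  then have "\<eta> > 0" "\<eta> \<le> 1" by (auto simp: \<eta>_def)
  have "c > 0"
    using \<open>m > 0\<close> \<open>\<eta> > 0\<close> d1 by (simp add: c_def)
  have kd: "k \<le> DIM('a)"
    using card_mono[OF finite_Basis K'] by (simp add: k_def)
  have lower: "ennreal (c * R powr (2 * s - real k)) \<le> I" if "R \<ge> 1" for R
  proof -
    define l u where "l = (\<Sum>b\<in>Basis. (if b \<in> K then 0 else R) *\<^sub>R b)"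
      and "u = (\<Sum>b\<in>Basis. (if b \<in> K then \<eta> else 2 * R) *\<^sub>R (b::'a))"
    have lu: "l \<bullet> b = (if b \<in> K then 0 else R)" "u \<bullet> b = (if b \<in> K then \<eta> else 2 * R)" if "b \<in> Basis" for b
      using that by (simp_all add: l_def u_def)
    have le: "l \<bullet> b \<le> u \<bullet> b" if "b \<in> Basis" for b
      using lu[OF that] \<open>R \<ge> 1\<close> \<open>\<eta> > 0\<close> by simp
    have vol: "emeasure lborel (cbox l u) = ennreal (\<eta> ^ k * R ^ (DIM('a) - k))"
    proof -
      have "(\<Prod>b\<in>Basis. (u - l) \<bullet> b) = (\<Prod>b\<in>Basis. if b \<in> K then \<eta> else R)"
        by (intro prod.cong) (auto simp: inner_diff_left lu)
      also have "\<dots> = \<eta> ^ card (Basis \<inter> K) * R ^ card (Basis \<inter> - K)"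
        by (simp add: prod.If_cases)
      also have "Basis \<inter> K = K"
        using K' by auto
      also have "Basis \<inter> - K = Basis - K"
        by auto
      also have "card (Basis - K) = DIM('a) - k"
        using K' finite_subset[OF K' finite_Basis] by (simp add: card_Diff_subset k_def)
      finally show ?thesis
        using le by (simp add: k_def)
    qed
    have integrand: "(m / 2) ^ 4 * (min 1 ((2 * d) powr q) * R powr q)
        \<le> norm (fourier_transform \<mu> z) powr (2 / (1 / 2)) * norm z powr (s / (1 / 2) - real DIM('a))"
      if z: "z \<in> cbox l u" for z
    proof (rule mult_mono)
      have zb: "\<bar>z \<bullet> b\<bar> \<le> (if b \<in> K then \<eta> else 2 * R)" if "b \<in> Basis" for b
        using z that lu[OF that] \<open>R \<ge> 1\<close> by (auto simp: mem_box split: if_splits)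
      have "\<bar>coord_proj K z \<bullet> b\<bar> \<le> \<eta>" if "b \<in> Basis" for b
        using zb[OF that] \<open>\<eta> > 0\<close> by (cases "b \<in> K") (auto simp: coord_proj_inner_Basis[OF K' that])
      then have "(\<Sum>b\<in>Basis. \<bar>coord_proj K z \<bullet> b\<bar>) \<le> real DIM('a) * \<eta>"
        by (intro sum_bounded_above) auto
      with norm_le_l1[of "coord_proj K z"] have "norm (coord_proj K z) \<le> real DIM('a) * \<eta>"
        by linarith
      also have "\<dots> = 1 / 6"
        using d1 by (simp add: \<eta>_def d_def)
      finally have "m / 2 \<le> norm (fourier_transform \<mu> z)"
        unfolding m_def by (rule norm_fourier_transform_ge_half_mass[OF K' fin sets AE])
      then have "(m / 2) ^ 4 \<le> norm (fourier_transform \<mu> z) ^ 4"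
        using \<open>m > 0\<close> by (intro power_mono) auto
      then show "(m / 2) ^ 4 \<le> norm (fourier_transform \<mu> z) powr (2 / (1 / 2))"
        by simp
      obtain b where b: "b \<in> Basis" "b \<notin> K" using K by blast
      have "R \<le> \<bar>z \<bullet> b\<bar>"
        using z b lu[OF b(1)] by (force simp: mem_box)
      then have lo: "R \<le> norm z"
        using Basis_le_norm[OF b(1), of z] by simp
      have "\<bar>z \<bullet> b\<bar> \<le> 2 * R" if "b \<in> Basis" for b
        using zb[OF that] \<open>\<eta> \<le> 1\<close> \<open>R \<ge> 1\<close> by (auto split: if_splits)
      then have "(\<Sum>b\<in>Basis. \<bar>z \<bullet> b\<bar>) \<le> real DIM('a) * (2 * R)"
        by (intro sum_bounded_above) auto
      with norm_le_l1[of z] have hi: "norm z \<le> 2 * d * R"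
        by (simp add: d_def)
      (* The exponent q can have either sign; use the lower or the upper bound for the norm of z accordingly. *)
      have "min 1 ((2 * d) powr q) * R powr q \<le> norm z powr q"
      proof (cases "q \<ge> 0")
        case True
        have "min 1 ((2 * d) powr q) * R powr q \<le> 1 * R powr q"
          by (intro mult_right_mono) auto
        also have "\<dots> \<le> norm z powr q"
          using True lo \<open>R \<ge> 1\<close> by (simp add: powr_mono2)
        finally show ?thesis .
      next
        case False
        have "min 1 ((2 * d) powr q) * R powr q \<le> (2 * d) powr q * R powr q"
          by (intro mult_right_mono) auto
        also have "\<dots> = (2 * d * R) powr q"
          using d1 \<open>R \<ge> 1\<close> by (simp add: powr_mult)
        also have "\<dots> \<le> norm z powr q"
          using False lo hi \<open>R \<ge> 1\<close> by (intro powr_mono2') auto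
        finally show ?thesis .
      qed
      then show "min 1 ((2 * d) powr q) * R powr q \<le> norm z powr (s / (1 / 2) - real DIM('a))"
        by (simp add: q_def d_def mult.commute)
    qed auto
    have "R powr q * R ^ (DIM('a) - k) = R powr (2 * s - real k)"
      using \<open>R \<ge> 1\<close> kd by (simp add: powr_realpow[symmetric] powr_add[symmetric] q_def d_def of_nat_diff)
    then have "c * R powr (2 * s - real k)
        = ((m / 2) ^ 4 * (min 1 ((2 * d) powr q) * R powr q)) * (\<eta> ^ k * R ^ (DIM('a) - k))"
      by (simp add: c_def mult_ac)
    then have "ennreal (c * R powr (2 * s - real k))
        = ennreal ((m / 2) ^ 4 * (min 1 ((2 * d) powr q) * R powr q)) * emeasure lborel (cbox l u)"
      unfolding vol by (simp add: ennreal_mult')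
    also have "\<dots> = (\<integral>\<^sup>+ z. ennreal ((m / 2) ^ 4 * (min 1 ((2 * d) powr q) * R powr q)) * indicator (cbox l u) z \<partial>lborel)"
      by (subst nn_integral_cmult_indicator) auto
    also have "\<dots> \<le> I"
      unfolding I_def
      using integrand by (intro nn_integral_mono) (auto simp: indicator_def intro!: ennreal_leI)
    finally show ?thesis .
  qed
  have "I = \<infinity>"
  proof (rule ccontr)
    assume "I \<noteq> \<infinity>"
    then obtain x where x: "x \<ge> 0" "I = ennreal x"
      by (cases I) auto
    define a where "a = 2 * s - real k"
    have "a > 0" using s by (simp add: a_def k_def)
    define R where "R = (x / c + 1) powr (1 / a)"
    have "R \<ge> 1"
      unfolding R_def using x \<open>a > 0\<close> \<open>c > 0\<close> by (intro ge_one_powr_ge_zero) auto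
    have "x + c = c * (x / c + 1)"
      using \<open>c > 0\<close> by (simp add: distrib_left)
    also have "\<dots> = c * R powr a"
      using \<open>a > 0\<close> \<open>c > 0\<close> x unfolding R_def powr_powr by simp
    also have "\<dots> \<le> x"
      using lower[OF \<open>R \<ge> 1\<close>] x by (simp add: a_def)
    finally show False
      using \<open>c > 0\<close> by simp
  qed
  then show ?thesis
    unfolding fourier_energy_def Let_def I_def[symmetric] by simp
qed

section \<open>Spectra and distances of coordinate spheres\<close>

lemma fourier_spectrum_coord_sphere_ge:
  fixes K :: "'a::euclidean_space set"
  assumes K: "K \<subseteq> Basis" "K \<noteq> {}" and "0 \<le> \<theta>"
  shows "ereal (min (\<theta> * real (card K)) (real (card K) - 1)) \<le> fourier_spectrum \<theta> (coord_sphere K)"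
proof (cases "min (\<theta> * real (card K)) (real (card K) - 1) \<le> 0")
  (* The case theta = 0 falls here. *)
  case True
  then have "ereal (min (\<theta> * real (card K)) (real (card K) - 1)) \<le> 0"
    by (simp only: zero_ereal_def ereal_less_eq)
  also have "0 \<le> fourier_spectrum \<theta> (coord_sphere K)"
    unfolding fourier_spectrum_def by (rule Sup_upper) simp
  finally show ?thesis .
next
  case False
  define m where "m = min (\<theta> * real (card K)) (real (card K) - 1)"
  define X where "X = fourier_spectrum_measure \<theta> (coord_sphere_measure K)"
  have "m > 0"
    using False unfolding m_def by linarith
  then have "\<theta> > 0"
    using \<open>0 \<le> \<theta>\<close> by (cases "\<theta> = 0") (auto simp: m_def)
  have below: "ereal s \<le> X" if "0 < s" "s < m" for s
    unfolding X_def fourier_spectrum_measure_def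
    using fourier_energy_coord_sphere_measure_finite[OF K \<open>\<theta> > 0\<close>, of s] that
    by (intro Sup_upper) (auto simp: m_def)
  have "ereal m \<le> X"
  proof (rule ccontr)
    assume "\<not> ereal m \<le> X"
    moreover have "0 \<le> X"
      unfolding X_def fourier_spectrum_measure_def by (rule Sup_upper) simp
    ultimately obtain x where x: "X = ereal x" "0 \<le> x" "x < m"
      by (cases X) auto
    then have "ereal ((x + m) / 2) \<le> X"
      by (intro below) auto
    then show False
      using x by simp
  qed
  moreover have "m \<le> real DIM('a)"
    using card_mono[OF finite_Basis K(1)] by (simp add: m_def)
  ultimately have "ereal m \<le> min X (ereal (real DIM('a)))"
    by simp
  also have "\<dots> \<le> fourier_spectrum \<theta> (coord_sphere K)"
    unfolding fourier_spectrum_def X_def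
    using coord_sphere_measure_in_finite_borel_measures_on[OF K] by (intro Sup_upper) auto
  finally show ?thesis
    by (simp add: m_def)
qed

lemma fourier_spectrum_half_coord_sphere_le:
  fixes K :: "'a::euclidean_space set"
  assumes K: "K \<subset> Basis"
  shows "fourier_spectrum (1 / 2) (coord_sphere K) \<le> ereal (real (card K) / 2)"
  unfolding fourier_spectrum_def
proof (rule Sup_least)
  fix X assume "X \<in> insert 0 ((\<lambda>\<mu>. min (fourier_spectrum_measure (1 / 2) \<mu>) (ereal (real DIM('a)))) ` finite_borel_measures_on (coord_sphere K))"
  then consider "X = 0" | \<mu> where "\<mu> \<in> finite_borel_measures_on (coord_sphere K)"
      "X = min (fourier_spectrum_measure (1 / 2) \<mu>) (ereal (real DIM('a)))"
    by blast
  then show "X \<le> ereal (real (card K) / 2)"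
  proof cases
    case 2
    have "s \<le> real (card K) / 2" if "fourier_energy s (1 / 2) \<mu> < \<infinity>" for s
      using fourier_energy_half_eq_infinity[OF K 2(1), of s] that by (cases "real (card K) / 2 < s") auto
    then have "fourier_spectrum_measure (1 / 2) \<mu> \<le> ereal (real (card K) / 2)"
      unfolding fourier_spectrum_measure_def by (intro Sup_least) auto
    then show ?thesis
      using 2(2) by (simp add: min.coboundedI1)
  qed simp
qed

lemma fourier_spectrum_half_coord_sphere:
  fixes K :: "'a::euclidean_space set"
  assumes "K \<subset> Basis" "2 \<le> card K"
  shows "fourier_spectrum (1 / 2) (coord_sphere K) = ereal (real (card K) / 2)"
proof (rule antisym)
  have "K \<noteq> {}"
    using assms(2) by auto
  have half: "min (1 / 2 * real (card K)) (real (card K) - 1) = real (card K) / 2"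
    using assms(2) by simp
  show "ereal (real (card K) / 2) \<le> fourier_spectrum (1 / 2) (coord_sphere K)"
    using fourier_spectrum_coord_sphere_ge[of K "1 / 2"] assms(1) \<open>K \<noteq> {}\<close> unfolding half by simp
qed (rule fourier_spectrum_half_coord_sphere_le[OF assms(1)])

text \<open>Points of the two spheres are orthogonal unit vectors.\<close>

lemma distance_set_coord_spheres:
  fixes K L :: "'a::euclidean_space set"
  assumes KL: "K \<subseteq> Basis" "L \<subseteq> Basis" "K \<inter> L = {}" and ne: "K \<noteq> {}" "L \<noteq> {}"
  shows "distance_set (coord_sphere K) (coord_sphere L) = {sqrt 2}"
proof -
  have dist: "norm (x - y) = sqrt 2" if x: "x \<in> coord_sphere K" and y: "y \<in> coord_sphere L" for x y
  proof -
    have "coord_proj K y = 0"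
    proof (rule euclidean_eqI)
      fix b :: 'a assume b: "b \<in> Basis"
      have "y \<bullet> b = 0" if "b \<in> K"
        using y KL(3) that b unfolding coord_sphere_def coord_proj_eq_iff[OF KL(2)] by auto
      then show "coord_proj K y \<bullet> b = 0 \<bullet> b"
        by (simp add: coord_proj_inner_Basis[OF KL(1) b])
    qed
    then have "x \<bullet> y = 0"
      using x coord_proj_inner_commute[of K x y] by (simp add: coord_sphere_def)
    moreover have "x \<bullet> x = 1" "y \<bullet> y = 1"
      using x y by (simp_all add: coord_sphere_def dot_square_norm)
    ultimately show ?thesis
      by (simp add: norm_eq_sqrt_inner inner_diff_left inner_diff_right inner_commute)
  qed
  obtain b c where bc: "b \<in> coord_sphere K" "c \<in> coord_sphere L"
    using ne KL Basis_in_coord_sphere by blast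
  show ?thesis
  proof
    show "distance_set (coord_sphere K) (coord_sphere L) \<subseteq> {sqrt 2}"
      using dist by (auto simp: distance_set_def)
    show "{sqrt 2} \<subseteq> distance_set (coord_sphere K) (coord_sphere L)"
      using bc dist[OF bc] by (force simp: distance_set_def)
  qed
qed

text \<open>The zero-dimensional measure of a point is 1, so the infimum defining the dimension is approached
through positive exponents, for which a point covers itself at cost zero.\<close>

lemma hausdorff_dim_singleton: "hausdorff_dim {x} = 0"
proof -
  have null: "hausdorff_measure s {x} = 0" if "s > 0" for s
  proof -
    have "hausdorff_premeasure s \<delta> {x} = 0" if "\<delta> > 0" for \<delta>
    proof -
      define U where "U = (\<lambda>i::nat. {x})"
      have "hausdorff_premeasure s \<delta> {x} \<le> (\<Sum>i. if U i = {} then 0 else ennreal (rpow (diameter (U i)) s))"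
        unfolding hausdorff_premeasure_def
        by (rule INF_lower) (use \<open>\<delta> > 0\<close> in \<open>auto simp: U_def\<close>)
      also have "\<dots> = 0"
        using \<open>s > 0\<close> by (simp add: U_def rpow_def)
      finally show ?thesis by simp
    qed
    then show ?thesis
      unfolding hausdorff_measure_def by (simp add: SUP_constant)
  qed
  show ?thesis
  proof (rule antisym)
    show "hausdorff_dim {x} \<le> 0"
    proof (rule ccontr)
      assume "\<not> hausdorff_dim {x} \<le> 0"
      then obtain e where e: "0 < ereal e" "ereal e < hausdorff_dim {x}"
        using ereal_dense2[of 0 "hausdorff_dim {x}"] by (auto simp: not_le)
      then have "hausdorff_dim {x} \<le> ereal e"
        unfolding hausdorff_dim_def using null[of e] by (intro Inf_lower) auto
      with e(2) show False by simp
    qed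
    show "0 \<le> hausdorff_dim {x}"
      unfolding hausdorff_dim_def by (rule Inf_greatest) auto
  qed
qed

theorem proposition3p1:
  fixes d k1 k2 :: nat
  assumes "d = CARD('n::finite)"
    and "d \<ge> 4"
    and "k1 = nat \<lceil>real d / 2\<rceil>"
    and "k2 = nat \<lfloor>real d / 2\<rfloor>"
  shows "k1 + k2 = d \<and>
    (\<exists>E F :: (real ^ 'n) set. compact E \<and> compact F \<and>
      distance_set E F = {sqrt 2} \<and>
      hausdorff_dim (distance_set E F) = 0 \<and>
      (\<forall>\<theta>\<in>{0..1}.
        fourier_spectrum \<theta> E \<ge> ereal (min (\<theta> * real k1) (real k1 - 1)) \<and>
        fourier_spectrum \<theta> F \<ge> ereal (min (\<theta> * real k2) (real k2 - 1))) \<and>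
      fourier_spectrum (1/2) E + fourier_spectrum (1/2) F = ereal (real d / 2) \<and>
      (fourier_spectrum (1/2) E + fourier_spectrum (1/2) F) / 2 - ereal (real d / 4) = 0 \<and>
      (fourier_spectrum (1/2) E + fourier_spectrum (1/2) F) / 2 - ereal (real d / 4)
        = hausdorff_dim (distance_set E F))"
proof -
  have k: "k1 + k2 = d" "k1 \<ge> 2" "k2 \<ge> 2"
    using assms(2-4) by linarith+
  have dim: "card (Basis :: (real ^ 'n) set) = d"
    using assms(1) by simp
  obtain K :: "(real ^ 'n) set" where K: "K \<subseteq> Basis" "card K = k1"
    using obtain_subset_with_card_n[of k1 "Basis :: (real ^ 'n) set"] k dim by (metis le_add1)
  define L where "L = Basis - K"
  have L: "L \<subseteq> Basis" "card L = k2"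
    using K k dim finite_subset[OF K(1) finite_Basis] by (auto simp: L_def card_Diff_subset)
  have ne: "K \<noteq> {}" "L \<noteq> {}"
    using K(2) L(2) k by auto
  have proper: "K \<subset> Basis" "L \<subset> Basis"
    using K(1) ne by (auto simp: L_def)
  let ?E = "coord_sphere K" and ?F = "coord_sphere L"
  have dist: "distance_set ?E ?F = {sqrt 2}"
    by (rule distance_set_coord_spheres[OF K(1) L(1) _ ne]) (auto simp: L_def)
  have hd: "hausdorff_dim (distance_set ?E ?F) = 0"
    by (simp add: dist hausdorff_dim_singleton)
  have sum: "fourier_spectrum (1/2) ?E + fourier_spectrum (1/2) ?F = ereal (real d / 2)"
    using fourier_spectrum_half_coord_sphere[OF proper(1)] fourier_spectrum_half_coord_sphere[OF proper(2)] K(2) L(2) k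
    by (simp add: add_divide_distrib[symmetric] flip: k(1))
  have avg: "(fourier_spectrum (1/2) ?E + fourier_spectrum (1/2) ?F) / 2 - ereal (real d / 4) = 0"
    unfolding sum by (simp add: zero_ereal_def)
  have "ereal (min (\<theta> * real k1) (real k1 - 1)) \<le> fourier_spectrum \<theta> ?E"
       "ereal (min (\<theta> * real k2) (real k2 - 1)) \<le> fourier_spectrum \<theta> ?F" if "\<theta> \<in> {0..1}" for \<theta>
    using fourier_spectrum_coord_sphere_ge[OF K(1) ne(1), of \<theta>]
      fourier_spectrum_coord_sphere_ge[OF L(1) ne(2), of \<theta>] that K(2) L(2) by auto
  then show ?thesis
    using k(1) compact_coord_sphere[of K] compact_coord_sphere[of L] dist hd sum avg
    by (intro conjI exI[of _ ?E] exI[of _ ?F]) auto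
qed

end
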